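(* Let $\epsilon>0$. Let $f$ be a real-valued function defined on pairs of positive integers $(a,n)$ with $a\le n$, such that $f$ depends only on the connected component of $v_a$ in $\mathcal{D}_{[a,n]}$ (respectively, only on the connected component of $v_a$ in $\mathcal{L}_{[a,n]}$), and such that $f(a,n)=O\left(\log\frac{n}{a}\right)$. Then the series $$C_f=\sum_{i=1}^{\infty}\ \sum_{\substack{d\ge 1\\ P^+(d)\le i}}\ \sum_{t\in[id,(i+1)d)}\left(\frac{f(d,t)}{t(t+1)}\prod_{p\le i}\frac{p-1}{p}\right)$$ (where $t$ runs over integers and $p$ over primes) defines a constant such that $$\sum_{a=1}^n f(a,n)=nC_f+O_\epsilon\left(n\exp\left(-(1-\epsilon)\sqrt{\log n\log\log n}\right)\right)$$ as $n\to\infty$ (the implied constant may also depend on $f$).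
   Context: For integers $k\le n$, $\mathcal{D}_{[k,n]}$ is the graph with vertices $v_k,\ldots,v_n$ and an edge between $v_i$ and $v_j$ if $i\mid j$ or $j\mid i$; $\mathcal{L}_{[k,n]}$ is the graph with the same vertices and an edge between $v_i$ and $v_j$ if $\operatorname{lcm}(i,j)\le n$. A function $f$ "depends only on the connected component of $v_a$ in $\mathcal{D}_{[a,n]}$" if $f(b,m)=f(b',m')$ whenever the connected component of $v_b$ in $\mathcal{D}_{[b,m]}$ is isomorphic (as a graph) to the connected component of $v_{b'}$ in $\mathcal{D}_{[b',m']}$ via an isomorphism sending $v_b$ to $v_{b'}$; analogously for $\mathcal{L}$. $P^+(d)$ denotes the largest prime factor of $d$, with $P^+(1)=1$. *)

theory Defs
  imports "HOL-Analysis.Analysis" "HOL-Library.Landau_Symbols" "HOL-Computational_Algebra.Primes"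
begin

definition gpf :: "nat \<Rightarrow> nat" where
  "gpf d = (if d \<le> 1 then 1 else Max (prime_factors d))"

definition graph_edges :: "(nat \<Rightarrow> nat \<Rightarrow> nat \<Rightarrow> bool) \<Rightarrow> nat \<Rightarrow> nat \<Rightarrow> (nat \<times> nat) set" where
  "graph_edges E k n = {(i, j). i \<in> {k..n} \<and> j \<in> {k..n} \<and> i \<noteq> j \<and> E n i j}"

definition component :: "(nat \<Rightarrow> nat \<Rightarrow> nat \<Rightarrow> bool) \<Rightarrow> nat \<Rightarrow> nat \<Rightarrow> nat \<Rightarrow> nat set" where
  "component E k n a = {b. (a, b) \<in> (graph_edges E k n)\<^sup>*}"

definition D_edge :: "nat \<Rightarrow> nat \<Rightarrow> nat \<Rightarrow> bool" where
  "D_edge n i j \<longleftrightarrow> i dvd j \<or> j dvd i"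

definition L_edge :: "nat \<Rightarrow> nat \<Rightarrow> nat \<Rightarrow> bool" where
  "L_edge n i j \<longleftrightarrow> lcm i j \<le> n"

definition rooted_iso :: "(nat \<Rightarrow> nat \<Rightarrow> nat \<Rightarrow> bool) \<Rightarrow> nat \<Rightarrow> nat \<Rightarrow> nat \<Rightarrow> nat \<Rightarrow> bool" where
  "rooted_iso E a n b m \<longleftrightarrow>
     (\<exists>g. bij_betw g (component E a n a) (component E b m b) \<and> g a = b \<and>
        (\<forall>x\<in>component E a n a. \<forall>y\<in>component E a n a.
            (x, y) \<in> graph_edges E a n \<longleftrightarrow> (g x, g y) \<in> graph_edges E b m))"

definition depends_only_on_component ::
    "(nat \<Rightarrow> nat \<Rightarrow> nat \<Rightarrow> bool) \<Rightarrow> (nat \<Rightarrow> nat \<Rightarrow> real) \<Rightarrow> bool" where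
  "depends_only_on_component E f \<longleftrightarrow>
     (\<forall>a n b m. 1 \<le> a \<longrightarrow> a \<le> n \<longrightarrow> 1 \<le> b \<longrightarrow> b \<le> m \<longrightarrow>
        rooted_iso E a n b m \<longrightarrow> f a n = f b m)"

definition Cf_term :: "(nat \<Rightarrow> nat \<Rightarrow> real) \<Rightarrow> nat \<Rightarrow> nat \<Rightarrow> real" where
  "Cf_term f i d = (\<Sum>t\<in>{i*d..<(i+1)*d}. f d t / (real t * (real t + 1)) *
      (\<Prod>p\<in>{p. prime p \<and> p \<le> i}. (real p - 1) / real p))"

end

theory Submission
  imports Defs "HOL-Real_Asymp.Real_Asymp"
begin

text \<open>
  Write \<open>i = n div a\<close> and factor \<open>a = m * d\<close>, where \<open>d\<close> has only prime factors \<open>\<le> i\<close> and \<open>m\<close> only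
  prime factors \<open>> i\<close>. Neighbours differ by cofactors \<open>\<le> i\<close>, hence coprime to \<open>m\<close>, so
  multiplication by \<open>m\<close> is a rooted isomorphism of components and \<open>f a n = f d (n div m)\<close>. The sum
  thus counts integers \<open>m\<close> in short intervals without prime factors \<open>\<le> i\<close>. For \<open>d\<close> up to
  nearly \<open>sqrt n\<close> they are counted by Brun's pure sieve, larger \<open>d\<close> are rare by Rankin's trick.
  Let \<open>S = sqrt (ln n * ln (ln n))\<close>. For \<open>i\<close> of size \<open>exp (c * S)\<close> both errors are about
  \<open>n * exp (- (c + 1 / (4 * c)) * S)\<close>, and \<open>c + 1 / (4 * c) \<ge> 1\<close>; the range \<open>i < exp (2 * S)\<close> is
  covered by finitely many such blocks and the rest is trivially small.
\<close>

section \<open>Smooth numbers and the sieve\<close>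

text \<open>What limits the saving is the Euler product over the primes up to y at exponent 1 -
  \<delta>, bounded below by the exponential of a constant times y^\<delta> * ln (ln y) from above.
  It has to be absorbed into exp (o(S)), so y^\<delta> is held to N^\<theta> with N = ln n and a
  fixed \<theta> < 1/2. For y = exp (c * S) this dictates \<delta> = \<theta> * ln N / (c * S), and
  n^(-\<delta>/2) becomes exp (-\<theta> * S / (2 * c)) because S^2 = N * ln N. As \<theta>
  approaches 1/2, this is the term 1 / (4 * c); the term c is the factor 1/i gained for i near y.
  Small and large d are made to pay the same price W * d^(\<delta> - 1): the sieve level depends on
  d to that end, and the free weight w of the sieve is set to y^\<delta>, the number that also
  governs the Rankin product. A single sum over smooth d then closes both estimates. The gap y^q
  left between d^2 and n makes the sieve remainders negligible, although there is one for every
  quotient i and every value of n div m.\<close>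

definition smooth_numbers :: "nat set \<Rightarrow> nat set" where
  "smooth_numbers Q = {d. d > 0 \<and> (\<forall>p. prime p \<longrightarrow> p dvd d \<longrightarrow> p \<in> Q)}"

text \<open>Real endpoints and an arbitrary set \<open>Q\<close> suit the induction over the sieving
  primes, which passes from the interval between x and x' to the one between x/p and x'/p.\<close>

definition sifted :: "nat set \<Rightarrow> real \<Rightarrow> real \<Rightarrow> nat set" where
  "sifted Q x x' = {m. x < real m \<and> real m \<le> x' \<and> (\<forall>p\<in>Q. \<not> p dvd m)}"

definition primes_le :: "real \<Rightarrow> nat set" where
  "primes_le y = {p. prime p \<and> real p \<le> y}"

lemma smooth_numbers_mono: "P \<subseteq> Q \<Longrightarrow> smooth_numbers P \<subseteq> smooth_numbers Q"
  by (auto simp: smooth_numbers_def)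

lemma primes_le_mono: "x \<le> y \<Longrightarrow> primes_le x \<subseteq> primes_le y"
  by (auto simp: primes_le_def)

lemma finite_primes_le [simp]: "finite (primes_le y)"
proof (rule finite_subset)
  show "primes_le y \<subseteq> {..nat \<lfloor>y\<rfloor>}"
    by (auto simp: primes_le_def le_nat_floor)
qed auto

lemma prime_primes_le: "p \<in> primes_le y \<Longrightarrow> prime p"
  by (simp add: primes_le_def)

lemma primes_le_of_nat: "primes_le (real i) = {p. prime p \<and> p \<le> i}"
  by (auto simp: primes_le_def)

text \<open>Since 1 is not prime there is room for the successor, which turns the sieve remainder
  \<open>(1 + real (card Q)) ^ r\<close> into a power of y.\<close>

lemma card_primes_le:
  assumes "i \<ge> 1"
  shows "Suc (card (primes_le (real i))) \<le> i"
proof -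
  have "card (primes_le (real i)) \<le> card {2..i}"
    by (rule card_mono) (auto simp: primes_le_of_nat prime_ge_2_nat)
  then show ?thesis using assms by simp
qed

text \<open>An Euler product bound for partial sums: splitting off the power of one prime leaves a
  geometric series times a sum over the remaining primes. Arbitrary finite \<open>X\<close> let the
  same bound yield summability, tails and truncated sums.\<close>

lemma sum_smooth_numbers_le:
  fixes s :: real
  assumes "finite Q" "\<And>p. p \<in> Q \<Longrightarrow> prime p" "s > 0" "finite X" "X \<subseteq> smooth_numbers Q"
  shows "(\<Sum>d\<in>X. real d powr -s) \<le> (\<Prod>p\<in>Q. 1 / (1 - real p powr -s))"
  using assms(1,2,4,5)
proof (induction Q arbitrary: X rule: finite_induct)
  case empty
  have "d = 1" if "d \<in> X" for d
  proof (rule ccontr)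
    assume "d \<noteq> 1"
    then obtain p where "prime p" "p dvd d" using prime_factor_nat by blast
    then show False using that empty by (auto simp: smooth_numbers_def)
  qed
  then have "X \<subseteq> {1}" by auto
  then have "(\<Sum>d\<in>X. real d powr -s) \<le> (\<Sum>d\<in>{1::nat}. real d powr -s)"
    by (intro sum_mono2) auto
  then show ?case by simp
next
  case (insert p Q)
  have p: "prime p" using insert by auto
  define x where "x = real p powr -s"
  have x: "0 \<le> x" "x < 1"
    using prime_gt_1_nat[OF p] \<open>s > 0\<close> by (auto simp: x_def powr_minus intro!: inverse_less_1_iff[THEN iffD2])
  define dec where "dec d = (multiplicity p d, d div p ^ multiplicity p d)" for d :: nat
  have dec: "p ^ fst (dec d) * snd (dec d) = d" for d
    by (simp add: dec_def multiplicity_dvd)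
  have snd_dec: "snd (dec d) \<in> smooth_numbers Q" if "d \<in> X" for d
  proof -
    have d: "d \<in> smooth_numbers (insert p Q)" using that insert by auto
    then have "d > 0" by (auto simp: smooth_numbers_def)
    then have "\<not> p dvd snd (dec d)"
      using multiplicity_decompose[of d p] p by (auto simp: dec_def simp del: One_nat_def dest: not_prime_unit)
    moreover have "snd (dec d) dvd d"
      using dvd_triv_right[of "snd (dec d)" "p ^ fst (dec d)"] unfolding dec .
    moreover have "snd (dec d) > 0" using \<open>d > 0\<close> \<open>snd (dec d) dvd d\<close> by (rule dvd_pos_nat)
    moreover have "q \<in> insert p Q" if "prime q" "q dvd snd (dec d)" for q
      using d that dvd_trans[OF that(2) \<open>snd (dec d) dvd d\<close>] by (simp add: smooth_numbers_def)
    ultimately show ?thesis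
      unfolding smooth_numbers_def by blast
  qed
  define M where "M = fst ` dec ` X"
  define Y where "Y = snd ` dec ` X"
  have fin: "finite M" "finite Y" using insert by (auto simp: M_def Y_def)
  have inj: "inj_on dec X"
    by (rule inj_on_inverseI[where g = "\<lambda>(k, e). p ^ k * e"]) (simp add: dec case_prod_unfold)
  have Y: "(\<Sum>d\<in>Y. real d powr -s) \<le> (\<Prod>p\<in>Q. 1 / (1 - real p powr -s))"
  proof (rule insert.IH)
    show "Y \<subseteq> smooth_numbers Q" using snd_dec by (auto simp: Y_def)
  qed (use fin insert.prems in auto)
  have "(\<Sum>k\<in>M. x ^ k) \<le> (\<Sum>k. x ^ k)"
    by (rule sum_le_suminf) (use x fin in \<open>auto intro: summable_geometric\<close>)
  also have "\<dots> = 1 / (1 - x)" using x by (simp add: suminf_geometric)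
  finally have M: "(\<Sum>k\<in>M. x ^ k) \<le> 1 / (1 - x)" .
  have "real d powr -s = x ^ fst (dec d) * real (snd (dec d)) powr -s" for d
  proof -
    have "real d powr -s = real (p ^ fst (dec d) * snd (dec d)) powr -s" by (simp only: dec)
    also have "\<dots> = (real p ^ fst (dec d)) powr -s * real (snd (dec d)) powr -s"
      by (simp add: powr_mult)
    also have "(real p ^ fst (dec d)) powr -s = x ^ fst (dec d)"
      using prime_gt_0_nat[OF p] by (simp add: x_def powr_realpow[symmetric] powr_powr mult.commute)
    finally show ?thesis .
  qed
  then have "(\<Sum>d\<in>X. real d powr -s) = (\<Sum>d\<in>X. x ^ fst (dec d) * real (snd (dec d)) powr -s)"
    by (rule sum.cong[OF refl])
  also have "\<dots> = (\<Sum>(k,e)\<in>dec ` X. x ^ k * real e powr -s)"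
    by (subst sum.reindex[OF inj]) (simp add: case_prod_unfold)
  \<comment> \<open>The image of \<open>X\<close> need not be a product set. Enlarging it to
    \<open>M \<times> Y\<close> adds only nonnegative terms and makes the sum factor.\<close>
  also have "\<dots> \<le> (\<Sum>(k,e)\<in>M \<times> Y. x ^ k * real e powr -s)"
  proof (rule sum_mono2)
    show "dec ` X \<subseteq> M \<times> Y" unfolding M_def Y_def by (rule subset_fst_snd)
  qed (use fin x in auto)
  also have "\<dots> = (\<Sum>k\<in>M. x ^ k) * (\<Sum>e\<in>Y. real e powr -s)"
    by (simp add: sum_product sum.cartesian_product)
  also have "\<dots> \<le> 1 / (1 - x) * (\<Prod>p\<in>Q. 1 / (1 - real p powr -s))"
    by (rule mult_mono) (use M Y x in \<open>auto intro: sum_nonneg\<close>)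
  finally show ?case using insert by (simp add: x_def)
qed

section \<open>Brun's sieve on short intervals\<close>

lemma floor_diff_bound:
  fixes x x' :: real
  assumes "0 \<le> x" "x \<le> x'"
  shows "finite {m::nat. x < real m \<and> real m \<le> x'}"
    and "\<bar>real (card {m::nat. x < real m \<and> real m \<le> x'}) - (x' - x)\<bar> \<le> 1"
proof -
  have "{m::nat. x < real m \<and> real m \<le> x'} = {nat \<lfloor>x\<rfloor><..nat \<lfloor>x'\<rfloor>}"
    using assms by (auto simp: nat_less_iff floor_less_iff le_nat_floor) linarith+
  then show "finite {m::nat. x < real m \<and> real m \<le> x'}"
    and "\<bar>real (card {m::nat. x < real m \<and> real m \<le> x'}) - (x' - x)\<bar> \<le> 1"
    using assms floor_mono[of x x'] by (auto simp: of_nat_diff nat_mono) linarith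
qed

text \<open>
  The right-hand side is a Chernoff-type bound for the recursion that each new prime \<open>p\<close> imposes via
  the count of multiples of \<open>p\<close>, so truncated inclusion-exclusion is not needed. The parameter \<open>r\<close>
  bounds the number of prime factors of the sieving moduli.
\<close>

lemma brun_sieve:
  fixes w x x' :: real
  assumes "finite Q" "\<And>p. p \<in> Q \<Longrightarrow> prime p" "w > 0" "0 \<le> x" "x \<le> x'"
  shows "\<bar>real (card (sifted Q x x')) - (x' - x) * (\<Prod>p\<in>Q. (real p - 1) / real p)\<bar>
     \<le> (x' - x) * (\<Prod>p\<in>Q. 1 + w / real p) / w ^ r + (1 + real (card Q)) ^ r"
  using assms(1,2,4,5)
proof (induction Q arbitrary: x x' r rule: finite_induct)
  case empty
  have "0 \<le> (x' - x) / w ^ r" using empty assms by simp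
  then show ?case using floor_diff_bound[of x x'] empty by (simp add: sifted_def)
next
  case (insert p Q)
  have p: "prime p" "real p > 0" using insert.prems by (auto simp: prime_gt_0_nat)
  have fin: "finite (sifted P x x')" for P and x x' :: real
    by (rule finite_subset[of _ "{..nat \<lfloor>x'\<rfloor>}"]) (auto simp: sifted_def le_nat_floor)
  have V: "0 \<le> (\<Prod>p\<in>insert p Q. (real p - 1) / real p)"
      "(\<Prod>p\<in>insert p Q. (real p - 1) / real p) \<le> 1"
      "1 \<le> (\<Prod>p\<in>insert p Q. 1 + w / real p)"
  proof -
    have "0 \<le> (real q - 1) / real q \<and> (real q - 1) / real q \<le> 1 \<and> 1 \<le> 1 + w / real q"
      if "q \<in> insert p Q" for q
      using prime_ge_1_nat[OF insert.prems(1)[OF that]] \<open>w > 0\<close> by (auto simp: divide_simps)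
    then show "0 \<le> (\<Prod>p\<in>insert p Q. (real p - 1) / real p)"
      "(\<Prod>p\<in>insert p Q. (real p - 1) / real p) \<le> 1"
      "1 \<le> (\<Prod>p\<in>insert p Q. 1 + w / real p)"
      by (blast intro!: prod_nonneg prod_le_1 prod_ge_1)+
  qed
  show ?case
  proof (cases r)
    case 0
    \<comment> \<open>At level 0 nothing is sieved: the count lies between 0 and x' - x + 1, the
      main term between 0 and x' - x, and the product of the factors 1 + w/p is at least 1.\<close>
    let ?S = "sifted (insert p Q) x x'"
    have "card ?S \<le> card {m::nat. x < real m \<and> real m \<le> x'}"
      using insert.prems by (intro card_mono floor_diff_bound) (auto simp: sifted_def)
    then have "real (card ?S) \<le> (x' - x) + 1"
      using floor_diff_bound(2)[of x x'] insert.prems by linarith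
    moreover have xx: "0 \<le> x' - x" using insert.prems by simp
    moreover note mult_left_mono[OF V(2) xx] mult_nonneg_nonneg[OF xx V(1)] mult_left_mono[OF V(3) xx]
    ultimately show ?thesis unfolding 0 power_0 div_by_1 mult_1_right abs_le_iff
      by (intro conjI) linarith+
  next
    case (Suc s)
    \<comment> \<open>Legendre's recursion: the multiples of p are removed from \<open>?A\<close>,
      and division by p carries them to \<open>?B\<close>. The first count is estimated at level r,
      the second at level r - 1; as \<open>1 / w ^ s = w / w ^ r\<close>, the two errors combine to
      the new factor 1 + w/p.\<close>
    let ?A = "sifted Q x x'" and ?B = "sifted Q (x / p) (x' / p)"
    define W where "W = (\<Prod>p\<in>Q. (real p - 1) / real p)"
    define U where "U = (\<Prod>p\<in>Q. 1 + w / real p)"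
    have "bij_betw ((*) p) ?B {m \<in> ?A. p dvd m}"
      unfolding bij_betw_def
    proof
      show "inj_on ((*) p) ?B" using p by (auto intro!: inj_onI)
      have "q dvd p * m \<longleftrightarrow> q dvd m" if "q \<in> Q" for q m
        using that insert.prems(1) insert.hyps by (metis insertCI prime_dvd_mult_iff primes_dvd_imp_eq)
      then have mem: "p * m \<in> ?A \<longleftrightarrow> m \<in> ?B" for m
        using p by (simp add: sifted_def field_simps)
      show "(*) p ` ?B = {m \<in> ?A. p dvd m}"
      proof (intro equalityI subsetI)
        fix m assume "m \<in> {m \<in> ?A. p dvd m}"
        then obtain k where "m = p * k" "p * k \<in> ?A" by (auto elim!: dvdE)
        then show "m \<in> (*) p ` ?B" using mem by blast
      qed (use mem in auto)
    qed
    then have "card {m \<in> ?A. p dvd m} = card ?B" by (simp add: bij_betw_same_card)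
    moreover have "sifted (insert p Q) x x' = ?A - {m \<in> ?A. p dvd m}"
      by (auto simp: sifted_def)
    moreover have "card {m \<in> ?A. p dvd m} \<le> card ?A" by (rule card_mono[OF fin]) auto
    ultimately have card: "real (card (sifted (insert p Q) x x')) = real (card ?A) - real (card ?B)"
      by (simp add: card_Diff_subset fin of_nat_diff)
    have A: "\<bar>real (card ?A) - (x' - x) * W\<bar> \<le> (x' - x) * U / w ^ r + (1 + real (card Q)) ^ r"
      unfolding W_def U_def by (rule insert.IH) (use insert.prems in auto)
    have B: "\<bar>real (card ?B) - (x' / p - x / p) * W\<bar>
        \<le> (x' / p - x / p) * U / w ^ s + (1 + real (card Q)) ^ s"
      unfolding W_def U_def by (rule insert.IH) (use insert.prems p in \<open>auto simp: divide_right_mono\<close>)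
    have "(x' - x) * ((real p - 1) / real p * W) = (x' - x) * W - (x' / p - x / p) * W"
      using p by (simp add: field_simps)
    moreover have "(x' - x) * ((1 + w / real p) * U) / w ^ r
        = (x' - x) * U / w ^ r + (x' / p - x / p) * U / w ^ s"
      using p \<open>w > 0\<close> by (simp add: Suc field_simps)
    moreover have "(1 + real (card Q)) ^ r + (1 + real (card Q)) ^ s \<le> (1 + real (card (insert p Q))) ^ r"
    proof -
      have "(1 + real (card Q)) ^ r + (1 + real (card Q)) ^ s
          = (1 + real (card Q)) ^ s * (2 + real (card Q))"
        by (simp add: Suc algebra_simps)
      also have "\<dots> \<le> (2 + real (card Q)) ^ s * (2 + real (card Q))"
        by (intro mult_right_mono power_mono) auto
      finally show ?thesis using insert.hyps by (simp add: Suc algebra_simps)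
    qed
    moreover have "(\<Prod>p\<in>insert p Q. (real p - 1) / real p) = (real p - 1) / real p * W"
      and "(\<Prod>p\<in>insert p Q. 1 + w / real p) = (1 + w / real p) * U"
      using insert.hyps by (simp_all add: W_def U_def)
    ultimately show ?thesis
      using A B card by (simp only: abs_le_iff) linarith
  qed
qed

section \<open>Chebyshev and Mertens upper bounds for primes\<close>

lemma prod_primes_dvd:
  fixes N :: nat
  assumes "finite P" "\<And>p. p \<in> P \<Longrightarrow> prime p" "\<And>p. p \<in> P \<Longrightarrow> p dvd N"
  shows "\<Prod>P dvd N"
  using assms
proof (induction P rule: finite_induct)
  case (insert p P)
  have "coprime p (\<Prod>P)"
    using insert by (intro prod_coprime_right) (metis insertCI primes_coprime)
  then show ?case using insert by (simp add: divides_mult)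
qed simp

text \<open>Chebyshev's argument: these primes all divide the central binomial coefficient of
  \<open>2 * 2 ^ k\<close>, which is at most \<open>2 ^ (2 * 2 ^ k)\<close>, while their product is
  at least \<open>2 ^ (k * card P)\<close>. With a power of two as base point, comparing exponents
  needs no logarithms.\<close>

lemma card_primes_dyadic:
  "k * card {p::nat. prime p \<and> 2 ^ k < p \<and> p \<le> 2 ^ Suc k} \<le> 2 ^ Suc k"
proof -
  define m :: nat where "m = 2 ^ k"
  define P where "P = {p::nat. prime p \<and> m < p \<and> p \<le> 2 * m}"
  have fin: "finite P" by (rule finite_subset[of _ "{..2*m}"]) (auto simp: P_def)
  have fact: "(2 * m choose m) * (fact m * fact m) = (fact (2 * m) :: nat)"
    using binomial_fact_lemma[of m "2 * m"] by (simp add: mult_ac)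
  have "p dvd (2 * m choose m)" if "p \<in> P" for p
  proof -
    from that have p: "prime p" "m < p" "p \<le> 2 * m" by (auto simp: P_def)
    then have "p dvd (2 * m choose m) * (fact m * fact m)"
      unfolding fact by (simp add: prime_dvd_fact_iff)
    moreover have "\<not> p dvd fact m" using p by (simp add: prime_dvd_fact_iff)
    ultimately show ?thesis using p by (simp add: prime_dvd_mult_iff)
  qed
  then have "\<Prod>P dvd (2 * m choose m)"
    by (intro prod_primes_dvd fin) (auto simp: P_def)
  then have "\<Prod>P \<le> (2 * m choose m)" by (simp add: dvd_imp_le)
  moreover have "(2 * m choose m) \<le> 2 ^ (2 * m)"
    using choose_row_sum[of "2 * m"] member_le_sum[of m "{..2*m}" "\<lambda>k. 2 * m choose k"] by simp
  moreover have "m ^ card P \<le> \<Prod>P"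
    using prod_mono[of P "\<lambda>_. m" "\<lambda>p. p"] by (auto simp: P_def)
  ultimately have "(2::nat) ^ (k * card P) \<le> 2 ^ (2 * m)"
    by (simp add: m_def power_mult)
  then show ?thesis by (simp add: P_def m_def)
qed

lemma harm_le_ln: "n \<ge> 1 \<Longrightarrow> harm n \<le> 1 + ln (real n)"
  using decseqD[OF decseq_harm_diff_ln, of 0 "n - 1"] by (simp add: harm_expand)

text \<open>The term 1/2 is the prime 2. By the preceding count, the primes between
  \<open>2 ^ k\<close> and \<open>2 ^ Suc k\<close> contribute at most 2/k, whence the harmonic
  number.\<close>

lemma sum_inverse_primes_pow2:
  "(\<Sum>p\<in>primes_le (2 ^ Suc k). 1 / real p) \<le> 1 / 2 + 2 * harm k"
proof (induction k)
  case 0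
  have "primes_le 2 = {2}"
    by (auto simp: primes_le_def dest: prime_ge_2_nat)
  then show ?case by (simp add: harm_expand)
next
  case (Suc k)
  define P where "P = {p::nat. prime p \<and> 2 ^ Suc k < p \<and> p \<le> 2 ^ Suc (Suc k)}"
  have split: "primes_le (2 ^ Suc (Suc k)) = primes_le (2 ^ Suc k) \<union> P"
  proof -
    have "real p \<le> 2 ^ j \<longleftrightarrow> p \<le> 2 ^ j" for p j :: nat
      by (metis of_nat_le_iff of_nat_numeral of_nat_power)
    then have "primes_le (2 ^ j) = {p. prime p \<and> p \<le> 2 ^ j}" for j
      by (simp add: primes_le_def)
    then show ?thesis unfolding P_def by (auto simp del: power_Suc intro: order_trans[OF _ power_increasing])
  qed
  have disj: "primes_le (2 ^ Suc k) \<inter> P = {}"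
  proof -
    have "p \<le> 2 ^ Suc k" if "real p \<le> 2 ^ Suc k" for p
      using that by (metis of_nat_le_iff of_nat_numeral of_nat_power)
    then show ?thesis by (auto simp: primes_le_def P_def simp del: power_Suc dest: leD)
  qed
  have fin: "finite P" by (rule finite_subset[of _ "{..2 ^ Suc (Suc k)}"]) (auto simp: P_def)
  have "(\<Sum>p\<in>P. 1 / real p) \<le> (\<Sum>p\<in>P. 1 / 2 ^ Suc k)"
  proof (rule sum_mono)
    fix p assume "p \<in> P"
    then have "real (2 ^ Suc k) \<le> real p" unfolding P_def of_nat_le_iff by simp
    then have "(2::real) ^ Suc k \<le> real p" by simp
    then show "1 / real p \<le> 1 / 2 ^ Suc k"
      by (intro frac_le) (auto simp del: power_Suc)
  qed
  also have "\<dots> = card P / 2 ^ Suc k" by simp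
  also have "\<dots> \<le> 2 / real (Suc k)"
  proof -
    have "real (Suc k * card P) \<le> real (2 ^ Suc (Suc k))"
      unfolding P_def of_nat_le_iff by (rule card_primes_dyadic)
    then show ?thesis by (simp add: field_simps)
  qed
  finally have "(\<Sum>p\<in>P. 1 / real p) \<le> 2 / real (Suc k)" .
  then show ?case
    unfolding split using Suc fin disj
    by (simp add: sum.union_disjoint harm_Suc inverse_eq_divide)
qed

text \<open>Mertens' upper bound with leading constant 2 in place of 1. The loss is harmless: the
  sum will be multiplied by a power N^\<theta> with \<theta> < 1/2 and only has to stay below a
  small multiple of S.\<close>

lemma sum_inverse_primes_le:
  assumes "y \<ge> 2"
  shows "(\<Sum>p\<in>primes_le y. 1 / real p) \<le> 3 + 2 * ln (2 * ln y)"
proof -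
  define k where "k = nat \<lfloor>log 2 y\<rfloor>"
  have l1: "log 2 y \<ge> 1" using assms by simp
  then have k: "k \<ge> 1" "real k \<le> log 2 y" "log 2 y \<le> real (Suc k)"
    unfolding k_def by linarith+
  then have "y \<le> 2 ^ Suc k"
    using assms log_le_iff[of 2 y "real (Suc k)"]
    by (simp add: powr_realpow[of 2 "Suc k", symmetric] del: power_Suc)
  then have "(\<Sum>p\<in>primes_le y. 1 / real p) \<le> (\<Sum>p\<in>primes_le (2 ^ Suc k). 1 / real p)"
    by (intro sum_mono2 primes_le_mono) auto
  also have "\<dots> \<le> 1 / 2 + 2 * harm k" by (rule sum_inverse_primes_pow2)
  also have "\<dots> \<le> 3 + 2 * ln (real k)" using harm_le_ln[OF k(1)] by simp
  also have "ln (real k) \<le> ln (2 * ln y)"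
  proof (subst ln_le_cancel_iff)
    have "log 2 y = ln y / ln 2" by (simp add: log_def)
    also have "\<dots> \<le> ln y / (1/2)"
      using ln2_ge_two_thirds assms by (intro divide_left_mono) auto
    finally show "real k \<le> 2 * ln y" using k by simp
  qed (use k assms in auto)
  finally show ?thesis by simp
qed

section \<open>Components of rough multiples\<close>

text \<open>Writing the lcm as \<open>z * k\<close>, the bound \<open>m * d \<le> z\<close> forces
  \<open>k \<le> n div (m * d)\<close>, so k shares no prime factor with m. As m divides
  \<open>z * k\<close>, it divides z. Thus edges starting at a multiple of m lead to multiples of
  m.\<close>

lemma dvd_of_lcm_le:
  fixes m d x z n :: nat
  assumes "m > 0" "d > 0" "x > 0" "m * d \<le> z"
    and rough: "\<And>p. prime p \<Longrightarrow> p dvd m \<Longrightarrow> n div (m * d) < p"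
    and lcm: "lcm (m * x) z \<le> n"
  shows "m dvd z"
proof -
  have "z > 0" using assms by (metis gr0I le_zero_eq mult_is_0 not_gr0)
  obtain k where k: "lcm (m * x) z = z * k" using dvd_lcm2 by (metis dvdE)
  have "k > 0" using k \<open>z > 0\<close> assms by (metis lcm_eq_0_iff mult_is_0 not_gr0)
  have "k \<le> n div z" using k lcm \<open>z > 0\<close> by (simp add: less_eq_div_iff_mult_less_eq mult.commute)
  also have "\<dots> \<le> n div (m * d)" using assms by (intro div_le_mono2) auto
  finally have "k \<le> n div (m * d)" .
  have "coprime m k"
  proof (rule ccontr)
    assume "\<not> coprime m k"
    then obtain p where p: "prime p" "p dvd m" "p dvd k"
      by (metis coprime_iff_gcd_eq_1 prime_factor_nat gcd_dvd1 gcd_dvd2 dvd_trans)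
    then have "p \<le> k" using \<open>k > 0\<close> by (simp add: dvd_imp_le)
    then show False using rough[OF p(1,2)] \<open>k \<le> n div (m * d)\<close> by simp
  qed
  moreover have "m dvd z * k" unfolding k[symmetric] by (metis dvd_lcm1 dvd_mult_left)
  ultimately show ?thesis by (simp add: coprime_dvd_mult_left_iff)
qed

text \<open>Lets one argument about neighbours, phrased with lcm, serve both graphs.\<close>

lemma D_edge_imp_L_edge: "D_edge n i j \<Longrightarrow> i \<le> n \<Longrightarrow> j \<le> n \<Longrightarrow> L_edge n i j"
  unfolding D_edge_def L_edge_def by (auto simp: lcm_nat_def lcm_proj2_if_dvd lcm_proj1_if_dvd)

lemma rooted_iso_rough_multiple:
  fixes m d n :: nat
  assumes E: "E = D_edge \<or> E = L_edge" and pos: "m > 0" "d > 0" and "m * d \<le> n"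
    and rough: "\<And>p. prime p \<Longrightarrow> p dvd m \<Longrightarrow> n div (m * d) < p"
  shows "rooted_iso E d (n div m) (m * d) n"
proof -
  let ?G = "graph_edges E d (n div m)" and ?H = "graph_edges E (m * d) n"
  \<comment> \<open>The multiples of m in \<open>{m * d..n}\<close> are m times
    \<open>{d..n div m}\<close>, and both edge relations are compatible with this scaling.\<close>
  have scale: "(m * x, m * y) \<in> ?H \<longleftrightarrow> (x, y) \<in> ?G" for x y
  proof -
    have "lcm (m * x) (m * y) = m * lcm x y" by (simp add: lcm_mult_left)
    then show ?thesis using E pos
      by (auto simp: graph_edges_def D_edge_def L_edge_def less_eq_div_iff_mult_less_eq mult.commute)
  qed
  have neighbour: "\<exists>y. z = m * y" if "(m * x, z) \<in> ?H" for x z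
  proof -
    from that have r: "m * d \<le> m * x" "m * x \<le> n" "m * d \<le> z" "z \<le> n" "E n (m * x) z"
      by (auto simp: graph_edges_def)
    then have "lcm (m * x) z \<le> n" using E D_edge_imp_L_edge by (auto simp: L_edge_def)
    moreover have "x > 0" using r pos by (cases x) auto
    ultimately have "m dvd z" using dvd_of_lcm_le[OF pos _ r(3) rough] by blast
    then show ?thesis by (auto elim: dvdE)
  qed
  \<comment> \<open>The inclusion from left to right is the one that rests on roughness: a path
    starting at \<open>m * d\<close> never leaves the multiples of m.\<close>
  have "component E (m * d) n (m * d) = (*) m ` component E d (n div m) d"
  proof (intro equalityI subsetI)
    fix z assume "z \<in> component E (m * d) n (m * d)"
    then have "(m * d, z) \<in> ?H\<^sup>*" by (simp add: component_def)
    then show "z \<in> (*) m ` component E d (n div m) d"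
    proof (induction rule: rtrancl_induct)
      case base
      then show ?case by (auto simp: component_def)
    next
      case (step y z)
      then obtain x where x: "y = m * x" "(d, x) \<in> ?G\<^sup>*" by (auto simp: component_def)
      with neighbour step obtain w where w: "z = m * w" by blast
      then have "(x, w) \<in> ?G" using step x scale by simp
      then show ?case using x w by (auto simp: component_def intro: rtrancl_into_rtrancl)
    qed
  next
    fix z assume "z \<in> (*) m ` component E d (n div m) d"
    then obtain x where x: "z = m * x" "(d, x) \<in> ?G\<^sup>*" by (auto simp: component_def)
    from x(2) have "(m * d, m * x) \<in> ?H\<^sup>*"
      by (induction rule: rtrancl_induct) (auto simp: scale intro: rtrancl_into_rtrancl)
    then show "z \<in> component E (m * d) n (m * d)" by (simp add: component_def x)
  qed
  then show ?thesis unfolding rooted_iso_def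
    using pos by (intro exI[of _ "(*) m"]) (auto simp: scale bij_betw_def inj_on_def)
qed

lemma depends_only_rough_multiple:
  fixes m d n :: nat
  assumes dep: "depends_only_on_component D_edge f \<or> depends_only_on_component L_edge f"
    and pos: "m > 0" "d > 0" and "m * d \<le> n"
    and rough: "\<And>p. prime p \<Longrightarrow> p dvd m \<Longrightarrow> n div (m * d) < p"
  shows "f (m * d) n = f d (n div m)"
proof -
  have iso: "rooted_iso E d (n div m) (m * d) n" if "E = D_edge \<or> E = L_edge" for E
    using rooted_iso_rough_multiple[OF that assms(2-5)] .
  have "1 \<le> d" "1 \<le> m * d" using pos by auto
  moreover have "d \<le> n div m" using assms by (simp add: less_eq_div_iff_mult_less_eq mult.commute)
  ultimately have "f d (n div m) = f (m * d) n"
    using dep assms(4) iso unfolding depends_only_on_component_def by blast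
  then show ?thesis ..
qed

section \<open>Reduction to smooth and rough factors\<close>

text \<open>Smooth part first, rough part second. For positive i the last condition also confines
  the product \<open>m * d\<close> to \<open>{1..n}\<close>.\<close>

definition factored_pairs :: "nat \<Rightarrow> nat \<Rightarrow> (nat \<times> nat) set" where
  "factored_pairs n i = {(d, m). d \<in> smooth_numbers (primes_le (real i)) \<and> m > 0 \<and>
     (\<forall>p. prime p \<longrightarrow> p dvd m \<longrightarrow> i < p) \<and> n div (m * d) = i}"

text \<open>Links the condition on all prime divisors with \<open>gpf\<close>. The case d = 1 is
  where \<open>i \<ge> 1\<close> enters, because \<open>gpf 1 = 1\<close>.\<close>

lemma smooth_numbers_gpf:
  assumes "i \<ge> 1"
  shows "smooth_numbers (primes_le (real i)) = {d. 1 \<le> d \<and> gpf d \<le> i}"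
proof -
  have "(\<forall>p. prime p \<longrightarrow> p dvd d \<longrightarrow> p \<le> i) \<longleftrightarrow> gpf d \<le> i" if "d \<ge> 1" for d
  proof (cases "d = 1")
    case False
    then obtain p where "prime p" "p dvd d" using prime_factor_nat by blast
    then have "p \<in> prime_factors d" using that by (simp add: prime_factors_dvd)
    then have "prime_factors d \<noteq> {}" by blast
    then show ?thesis using that False by (auto simp: gpf_def prime_factors_dvd)
  qed (use assms in \<open>auto simp: gpf_def\<close>)
  then show ?thesis by (auto simp: smooth_numbers_def primes_le_def)
qed

lemma smooth_rough_coprime:
  assumes "d \<in> smooth_numbers (primes_le (real i))" "\<forall>p. prime p \<longrightarrow> p dvd m \<longrightarrow> i < p"
  shows "coprime d m"
proof (rule ccontr)
  assume "\<not> coprime d m"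
  then obtain p where "prime p" "p dvd d" "p dvd m"
    by (metis coprime_iff_gcd_eq_1 prime_factor_nat gcd_dvd1 gcd_dvd2 dvd_trans)
  moreover from this have "p \<le> i" using assms(1) by (simp add: smooth_numbers_def primes_le_def)
  ultimately show False using assms(2) leD by blast
qed

lemma smooth_rough_factorization:
  fixes a :: nat
  assumes "a > 0"
  shows "\<exists>d m. d \<in> smooth_numbers (primes_le (real i)) \<and> m > 0 \<and>
     (\<forall>p. prime p \<longrightarrow> p dvd m \<longrightarrow> i < p) \<and> a = m * d"
  using assms
proof (induction a rule: prime_divisors_induct)
  case (unit x)
  then show ?case by (intro exI[of _ 1]) (auto simp: smooth_numbers_def)
next
  case (factor p x)
  then obtain d m where dm: "d \<in> smooth_numbers (primes_le (real i))" "m > 0"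
    "\<forall>p. prime p \<longrightarrow> p dvd m \<longrightarrow> i < p" "x = m * d" by auto
  show ?case
  proof (cases "p \<le> i")
    case True
    have "p * d \<in> smooth_numbers (primes_le (real i))"
      using dm factor True prime_gt_0_nat[of p]
      by (auto simp: smooth_numbers_def prime_dvd_mult_iff primes_le_def dest: primes_dvd_imp_eq)
    then show ?thesis using dm by (intro exI[of _ "p * d"] exI[of _ m]) auto
  next
    case False
    then have "\<forall>q. prime q \<longrightarrow> q dvd p * m \<longrightarrow> i < q"
      using dm factor by (auto simp: prime_dvd_mult_iff dest: primes_dvd_imp_eq)
    then show ?thesis using dm factor prime_gt_0_nat[of p]
      by (intro exI[of _ d] exI[of _ "p * m"]) auto
  qed
qed auto

lemma bij_betw_factored_pairs:
  assumes "i \<ge> 1"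
  shows "bij_betw (\<lambda>(d, m). m * d) (factored_pairs n i) {a \<in> {1..n}. n div a = i}"
  unfolding bij_betw_def
proof
  show "inj_on (\<lambda>(d, m). m * d) (factored_pairs n i)"
  proof (rule inj_onI, clarify)
    fix d m d' m' assume *: "(d, m) \<in> factored_pairs n i" "(d', m') \<in> factored_pairs n i" "m * d = m' * d'"
    \<comment> \<open>Coprimality across the two pairs: from d dividing \<open>m' * d'\<close> it
      follows that d divides d', and symmetrically.\<close>
    then have "coprime d m'" "coprime d' m" "m > 0" "d > 0"
      by (auto simp: factored_pairs_def smooth_numbers_def intro: smooth_rough_coprime)
    moreover have "d dvd m' * d'" "d' dvd m * d" using * by (metis dvd_triv_right)+
    ultimately have "d = d'"
      by (metis coprime_dvd_mult_right_iff dvd_antisym)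
    then show "d = d' \<and> m = m'" using * \<open>d > 0\<close> by simp
  qed
  show "(\<lambda>(d, m). m * d) ` factored_pairs n i = {a \<in> {1..n}. n div a = i}"
  proof (intro equalityI subsetI)
    fix a assume "a \<in> {a \<in> {1..n}. n div a = i}"
    then have "a > 0" "n div a = i" by auto
    with smooth_rough_factorization[OF this(1), of i] show "a \<in> (\<lambda>(d, m). m * d) ` factored_pairs n i"
      by (fastforce simp: factored_pairs_def)
  next
    fix a assume "a \<in> (\<lambda>(d, m). m * d) ` factored_pairs n i"
    then show "a \<in> {a \<in> {1..n}. n div a = i}"
      using assms by (auto simp: factored_pairs_def smooth_numbers_def div_greater_zero_iff Suc_le_eq)
  qed
qed

lemma sum_factored_pairs:
  assumes dep: "depends_only_on_component D_edge f \<or> depends_only_on_component L_edge f" and "i \<ge> 1"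
  shows "(\<Sum>a | a \<in> {1..n} \<and> n div a = i. f a n) = (\<Sum>(d, m)\<in>factored_pairs n i. f d (n div m))"
proof -
  have "f (m * d) n = f d (n div m)" if "(d, m) \<in> factored_pairs n i" for d m
    using that \<open>i \<ge> 1\<close>
    by (intro depends_only_rough_multiple[OF dep])
      (auto simp: factored_pairs_def smooth_numbers_def div_greater_zero_iff Suc_le_eq)
  then show ?thesis
    unfolding sum.reindex_bij_betw[OF bij_betw_factored_pairs[OF \<open>i \<ge> 1\<close>], symmetric]
    by (intro sum.cong) auto
qed

lemma finite_factored_pairs: "i \<ge> 1 \<Longrightarrow> finite (factored_pairs n i)"
  using bij_betw_finite[OF bij_betw_factored_pairs] by simp

section \<open>Grouping by the value of \<open>n div m\<close> and counting the fibres\<close>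

lemma sum_inverse_successive:
  assumes "1 \<le> a" "a \<le> b"
  shows "(\<Sum>t\<in>{a..<b}. 1 / (real t * (real t + 1))) = 1 / real a - 1 / real b"
  using assms(2)
proof (induction b rule: dec_induct)
  case (step k)
  then have "1 / (real k * (real k + 1)) = 1 / real k - 1 / real (Suc k)"
    using assms(1) by (simp add: field_simps)
  then show ?case using step by simp
qed simp

text \<open>The factor 1/d that emerges here is what turns sums over smooth d into Euler
  products.\<close>

lemma sum_inverse_successive_block:
  assumes "1 \<le> i" "1 \<le> d"
  shows "(\<Sum>t\<in>{i*d..<(i+1)*d}. 1 / (real t * (real t + 1))) = 1 / (real i * (real i + 1) * real d)"
proof -
  have "(\<Sum>t\<in>{i*d..<(i+1)*d}. 1 / (real t * (real t + 1))) = 1 / real (i*d) - 1 / real ((i+1)*d)"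
    using assms by (intro sum_inverse_successive) auto
  also have "\<dots> = (1 / real i - 1 / (real i + 1)) / real d"
    by (simp only: of_nat_mult of_nat_add of_nat_1 diff_divide_distrib divide_divide_eq_left)
  also have "1 / real i - 1 / (real i + 1) = 1 / (real i * (real i + 1))"
    using assms by (simp add: field_simps)
  also have "\<dots> / real d = 1 / (real i * (real i + 1) * real d)" by simp
  finally show ?thesis .
qed

text \<open>The fibre is a half-open interval of length \<open>n / (t * (t + 1))\<close>. This is
  the origin of the weight in \<open>Cf_term\<close>; the product of (p - 1)/p there is the density
  of the sifted numbers.\<close>

lemma rough_fiber_eq_sifted:
  assumes "t \<ge> 1"
  shows "{m. m > 0 \<and> (\<forall>p. prime p \<longrightarrow> p dvd m \<longrightarrow> i < p) \<and> n div m = t}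
     = sifted (primes_le (real i)) (real n / (real t + 1)) (real n / real t)"
proof -
  have "m > 0 \<and> n div m = t \<longleftrightarrow> real n / (real t + 1) < real m \<and> real m \<le> real n / real t" for m
  proof -
    have "real n / (real t + 1) < real m \<longleftrightarrow> n < m * (t + 1)"
    proof -
      have "real m * (real t + 1) = real (m * (t + 1))" by (simp add: algebra_simps)
      then show ?thesis by (simp only: pos_divide_less_eq of_nat_less_iff of_nat_0_le_iff add_nonneg_pos zero_less_one)
    qed
    moreover have "real m \<le> real n / real t \<longleftrightarrow> m * t \<le> n"
      using assms by (simp add: pos_le_divide_eq flip: of_nat_mult)
    moreover have "m > 0 \<and> n div m = t \<longleftrightarrow> n < m * (t + 1) \<and> m * t \<le> n"
      by (cases "m = 0") (auto simp: div_nat_eqI dividend_less_times_div mult.commute)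
    ultimately show ?thesis by simp
  qed
  moreover have "(\<forall>p. prime p \<longrightarrow> p dvd m \<longrightarrow> i < p) \<longleftrightarrow> (\<forall>p\<in>primes_le (real i). \<not> p dvd m)" for m
    unfolding primes_le_of_nat using not_le by blast
  ultimately show ?thesis unfolding sifted_def by blast
qed

lemma div_mult_eq_iff:
  fixes n m d i :: nat
  assumes "d \<ge> 1"
  shows "n div (m * d) = i \<longleftrightarrow> n div m \<in> {i*d..<(i+1)*d}"
proof -
  have "k div d = i \<longleftrightarrow> k \<in> {i*d..<(i+1)*d}" for k
    using dividend_less_div_times[of d k] div_times_less_eq_dividend[of k d] assms
    by (auto simp: mult.commute intro: div_nat_eqI)
  then show ?thesis by (simp add: div_mult2_eq)
qed

text \<open>For fixed d the summand depends on m only through t = n div m, so the sieve is applied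
  to each fibre. The d possible values of t produce the remainder \<open>d * y ^ r\<close>. The
  error is enlarged from primes up to i to primes up to y, to be uniform over a block of
  quotients.\<close>

lemma sum_rough_bound:
  fixes f :: "nat \<Rightarrow> nat \<Rightarrow> real"
  assumes "i \<ge> 1" "d \<ge> 1" "real i \<le> y" "w > 0"
    and fB: "\<And>t. t \<in> {i*d..<(i+1)*d} \<Longrightarrow> \<bar>f d t\<bar> \<le> B"
  shows "\<bar>(\<Sum>m | m > 0 \<and> (\<forall>p. prime p \<longrightarrow> p dvd m \<longrightarrow> i < p) \<and> n div (m * d) = i. f d (n div m))
      - real n * Cf_term f i d\<bar>
    \<le> B * (real n / (real i * (real i + 1) * real d) * (\<Prod>p\<in>primes_le y. 1 + w / real p) / w ^ r
        + real d * y ^ r)"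
proof -
  let ?rough = "\<lambda>m. m > 0 \<and> (\<forall>p. prime p \<longrightarrow> p dvd m \<longrightarrow> i < p)"
  let ?T = "{i*d..<(i+1)*d}"
  define M where "M = {m. ?rough m \<and> n div (m * d) = i}"
  define V where "V = (\<Prod>p\<in>{p. prime p \<and> p \<le> i}. (real p - 1) / real p)"
  define U where "U = (\<Prod>p\<in>primes_le y. 1 + w / real p)"
  define R where "R t = real (card (sifted (primes_le (real i)) (real n / (real t + 1)) (real n / real t)))" for t
  note eq_iff = div_mult_eq_iff[OF assms(2)]
  have M_finite: "finite M"
  proof (rule finite_subset)
    show "M \<subseteq> {..n}"
    proof
      fix m assume "m \<in> M"
      then have "n div (m * d) \<ge> 1" using assms by (auto simp: M_def)
      then have "m * d \<le> n" by (metis div_less not_less One_nat_def not_one_le_zero)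
      then show "m \<in> {..n}" using assms(2) by (cases d) auto
    qed
  qed auto
  have "(\<Sum>m\<in>M. f d (n div m)) = (\<Sum>t\<in>?T. \<Sum>m\<in>{m \<in> M. n div m = t}. f d (n div m))"
    by (rule sum.group[symmetric]) (use M_finite eq_iff in \<open>auto simp: M_def\<close>)
  also have "\<dots> = (\<Sum>t\<in>?T. f d t * R t)"
  proof (rule sum.cong[OF refl])
    fix t assume t: "t \<in> ?T"
    have "t \<ge> 1" using t assms by (metis atLeastLessThan_iff le_trans mult_le_mono nat_mult_1)
    have "{m \<in> M. n div m = t} = {m. m > 0 \<and> (\<forall>p. prime p \<longrightarrow> p dvd m \<longrightarrow> i < p) \<and> n div m = t}"
      using t eq_iff by (auto simp: M_def)
    then have "real (card {m \<in> M. n div m = t}) = R t"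
      using rough_fiber_eq_sifted[OF \<open>t \<ge> 1\<close>] by (simp add: R_def)
    then show "(\<Sum>m\<in>{m \<in> M. n div m = t}. f d (n div m)) = f d t * R t" by simp
  qed
  finally have sum: "(\<Sum>m\<in>M. f d (n div m)) = (\<Sum>t\<in>?T. f d t * R t)" .
  have B: "B \<ge> 0" using fB[of "i * d"] assms(2) by fastforce
  have "\<bar>(\<Sum>m\<in>M. f d (n div m)) - real n * Cf_term f i d\<bar>
      = \<bar>\<Sum>t\<in>?T. f d t * (R t - real n / (real t * (real t + 1)) * V)\<bar>"
    unfolding sum Cf_term_def V_def[symmetric]
    by (simp add: sum_distrib_left algebra_simps flip: sum_subtractf)
  also have "\<dots> \<le> (\<Sum>t\<in>?T. B * (real n * (1 / (real t * (real t + 1))) * U / w ^ r + y ^ r))"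
  proof (rule order_trans[OF sum_abs sum_mono])
    fix t assume t: "t \<in> ?T"
    have "t \<ge> 1" using t assms by (metis atLeastLessThan_iff le_trans mult_le_mono nat_mult_1)
    have len: "real n / real t - real n / (real t + 1) = real n * (1 / (real t * (real t + 1)))"
      using \<open>t \<ge> 1\<close> by (simp add: field_simps)
    have len0: "real n / (real t + 1) \<le> real n / real t" using \<open>t \<ge> 1\<close> by (intro divide_left_mono) auto
    have "\<bar>R t - real n * (1 / (real t * (real t + 1))) * V\<bar>
       \<le> real n * (1 / (real t * (real t + 1))) * (\<Prod>p\<in>primes_le (real i). 1 + w / real p) / w ^ r
          + (1 + real (card (primes_le (real i)))) ^ r"
      using brun_sieve[of "primes_le (real i)" w "real n / (real t + 1)" "real n / real t" r]
        len0 \<open>w > 0\<close> unfolding len R_def V_def primes_le_of_nat[symmetric]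
      by (simp add: prime_primes_le)
    also have "\<dots> \<le> real n * (1 / (real t * (real t + 1))) * U / w ^ r + y ^ r"
    proof -
      have "(\<Prod>p\<in>primes_le (real i). 1 + w / real p) \<le> U"
        unfolding U_def using assms by (intro prod_mono2 primes_le_mono) (auto intro: add_nonneg_nonneg)
      moreover have "real (Suc (card (primes_le (real i)))) \<le> y"
        using card_primes_le[OF assms(1)] assms(3) by linarith
      ultimately show ?thesis using assms
        by (intro add_mono divide_right_mono mult_left_mono power_mono) auto
    qed
    finally have "\<bar>R t - real n * (1 / (real t * (real t + 1))) * V\<bar>
      \<le> real n * (1 / (real t * (real t + 1))) * U / w ^ r + y ^ r" .
    then show "\<bar>f d t * (R t - real n / (real t * (real t + 1)) * V)\<bar>
       \<le> B * (real n * (1 / (real t * (real t + 1))) * U / w ^ r + y ^ r)"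
      using fB[OF t] B by (simp add: abs_mult mult_mono)
  qed
  also have "\<dots> = B * (real n * (\<Sum>t\<in>?T. 1 / (real t * (real t + 1))) * U / w ^ r + real d * y ^ r)"
    by (simp add: sum.distrib sum_distrib_left sum_distrib_right sum_divide_distrib algebra_simps)
  also have "\<dots> = B * (real n / (real i * (real i + 1) * real d) * U / w ^ r + real d * y ^ r)"
    unfolding sum_inverse_successive_block[OF assms(1,2)] by simp
  finally show ?thesis unfolding M_def U_def by simp
qed

section \<open>The error for a block of quotients\<close>

lemma summable_on_of_bounded_abs_sums:
  fixes g :: "'a \<Rightarrow> real"
  assumes "\<And>F. finite F \<Longrightarrow> F \<subseteq> A \<Longrightarrow> (\<Sum>x\<in>F. \<bar>g x\<bar>) \<le> M"
  shows "g summable_on A" and "\<bar>infsum g A\<bar> \<le> M"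
proof -
  have abs: "(\<lambda>x. norm (g x)) summable_on A"
    using assms by (intro nonneg_bdd_above_summable_on bdd_aboveI[of _ M]) auto
  then show "g summable_on A" by (rule abs_summable_summable)
  have "norm (infsum g A) \<le> (\<Sum>\<^sub>\<infinity>x\<in>A. norm (g x))"
    by (rule norm_infsum_bound[OF abs])
  also have "\<dots> \<le> M"
    by (rule infsum_le_finite_sums[OF abs]) (use assms in auto)
  finally show "\<bar>infsum g A\<bar> \<le> M" by simp
qed

lemma prod_one_minus_inverse_primes_bounds:
  "0 \<le> (\<Prod>p\<in>{p. prime p \<and> p \<le> i}. (real p - 1) / real p)"
  "(\<Prod>p\<in>{p. prime p \<and> p \<le> i}. (real p - 1) / real p) \<le> 1"
proof -
  have "0 \<le> (real p - 1) / real p \<and> (real p - 1) / real p \<le> 1" if "p \<in> {p. prime p \<and> p \<le> i}" for p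
    using that prime_ge_1_nat[of p] by (auto simp: divide_simps)
  then show "0 \<le> (\<Prod>p\<in>{p. prime p \<and> p \<le> i}. (real p - 1) / real p)"
    "(\<Prod>p\<in>{p. prime p \<and> p \<le> i}. (real p - 1) / real p) \<le> 1"
    by (blast intro!: prod_nonneg prod_le_1)+
qed

lemma abs_Cf_term_le:
  assumes "i \<ge> 1" "d \<ge> 1" and fB: "\<And>t. t \<in> {i*d..<(i+1)*d} \<Longrightarrow> \<bar>f d t\<bar> \<le> B"
  shows "\<bar>Cf_term f i d\<bar> \<le> B * (\<Prod>p\<in>{p. prime p \<and> p \<le> i}. (real p - 1) / real p)
           / (real i * (real i + 1)) * (1 / real d)"
proof -
  define V where "V = (\<Prod>p\<in>{p. prime p \<and> p \<le> i}. (real p - 1) / real p)"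
  have V: "V \<ge> 0" unfolding V_def by (rule prod_one_minus_inverse_primes_bounds)
  have "\<bar>Cf_term f i d\<bar> \<le> (\<Sum>t\<in>{i*d..<(i+1)*d}. B * V * (1 / (real t * (real t + 1))))"
    unfolding Cf_term_def V_def[symmetric]
  proof (rule order_trans[OF sum_abs sum_mono])
    fix t assume t: "t \<in> {i*d..<(i+1)*d}"
    have "\<bar>f d t\<bar> * (1 / (real t * (real t + 1)) * V) \<le> B * (1 / (real t * (real t + 1)) * V)"
      using V by (intro mult_right_mono fB t) auto
    then show "\<bar>f d t / (real t * (real t + 1)) * V\<bar> \<le> B * V * (1 / (real t * (real t + 1)))"
      using V by (simp add: abs_mult mult_ac)
  qed
  also have "\<dots> = B * V * (1 / (real i * (real i + 1) * real d))"
    unfolding sum_inverse_successive_block[OF assms(1,2), symmetric] by (rule sum_distrib_left[symmetric])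
  finally show ?thesis by (simp add: V_def)
qed

text \<open>The product of (p - 1)/p inside \<open>Cf_term\<close> cancels the Euler product that
  bounds the sum of 1/d over smooth d. What remains is \<open>B / (i * (i + 1))\<close>; with B
  logarithmic in i, this makes the outer series converge.\<close>

lemma Cf_term_summable:
  assumes "i \<ge> 1" and fB: "\<And>d t. d \<ge> 1 \<Longrightarrow> t \<in> {i*d..<(i+1)*d} \<Longrightarrow> \<bar>f d t\<bar> \<le> B"
  shows "Cf_term f i summable_on smooth_numbers (primes_le (real i))"
    and "\<bar>infsum (Cf_term f i) (smooth_numbers (primes_le (real i)))\<bar> \<le> B / (real i * (real i + 1))"
proof -
  define V where "V = (\<Prod>p\<in>{p. prime p \<and> p \<le> i}. (real p - 1) / real p)"
  have V: "V \<ge> 0" unfolding V_def by (rule prod_one_minus_inverse_primes_bounds)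
  have B: "B \<ge> 0" using fB[of 1 i] by fastforce
  have *: "(\<Sum>d\<in>F. \<bar>Cf_term f i d\<bar>) \<le> B / (real i * (real i + 1))"
    if F: "finite F" "F \<subseteq> smooth_numbers (primes_le (real i))" for F
  proof -
    have "(\<Sum>d\<in>F. real d powr -1) \<le> (\<Prod>p\<in>primes_le (real i). 1 / (1 - real p powr -1))"
      using F by (intro sum_smooth_numbers_le) (auto simp: prime_primes_le)
    also have "\<dots> = (\<Prod>p\<in>primes_le (real i). inverse ((real p - 1) / real p))"
    proof (rule prod.cong[OF refl])
      fix p assume "p \<in> primes_le (real i)"
      then have "p > 1" using prime_primes_le prime_gt_1_nat by blast
      then show "1 / (1 - real p powr -1) = inverse ((real p - 1) / real p)"
        by (simp add: powr_minus field_simps)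
    qed
    also have "\<dots> = inverse V" unfolding V_def primes_le_of_nat by (simp only: prod_inversef[symmetric] comp_def)
    finally have sum: "(\<Sum>d\<in>F. 1 / real d) \<le> inverse V"
      by (simp add: powr_minus inverse_eq_divide)
    have "(\<Sum>d\<in>F. \<bar>Cf_term f i d\<bar>) \<le> (\<Sum>d\<in>F. B * V / (real i * (real i + 1)) * (1 / real d))"
      unfolding V_def
      by (intro sum_mono abs_Cf_term_le fB assms) (use F in \<open>auto simp: smooth_numbers_def\<close>)
    also have "\<dots> = B * V / (real i * (real i + 1)) * (\<Sum>d\<in>F. 1 / real d)"
      by (rule sum_distrib_left[symmetric])
    also have "\<dots> \<le> B * V / (real i * (real i + 1)) * inverse V"
      using sum B V by (intro mult_left_mono) auto
    also have "\<dots> = B / (real i * (real i + 1)) * (V * inverse V)" by simp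
    also have "\<dots> \<le> B / (real i * (real i + 1)) * 1"
    proof (rule mult_left_mono)
      show "V * inverse V \<le> 1" by (cases "V = 0") auto
    qed (use B in simp)
    finally show ?thesis by simp
  qed
  show "Cf_term f i summable_on smooth_numbers (primes_le (real i))"
    "\<bar>infsum (Cf_term f i) (smooth_numbers (primes_le (real i)))\<bar> \<le> B / (real i * (real i + 1))"
    using summable_on_of_bounded_abs_sums[OF *] by auto
qed

text \<open>Here r is the largest exponent with \<open>y ^ r \<le> X\<close>, where
  \<open>X = n / (d ^ 2 * y ^ q)\<close>: the upper bound on \<open>y ^ r\<close> controls the sieve
  remainder, and maximality gives \<open>X \<le> y ^ (r + 1)\<close>. As d is at most the root of n,
  X is at least sqrt n / (d * y^q); raising this to the power \<delta> gives the second claim.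
  Trading n / d^2 for its root gives the bound the shape of Rankin's weight for large d.\<close>

lemma exists_sieve_level:
  fixes y \<delta> :: real
  assumes "d \<ge> 1" "y > 1" "0 < \<delta>" and n: "real d ^ 2 * y ^ q \<le> real n"
  obtains r where "real d * y ^ r \<le> real n / (real d * y ^ q)"
    "1 / (y powr \<delta>) ^ r \<le> (y powr \<delta>) ^ (q + 1) * real n powr (- \<delta> / 2) * real d powr \<delta>"
proof -
  define X where "X = real n / (real d ^ 2 * y ^ q)"
  define r where "r = nat \<lfloor>log y X\<rfloor>"
  define w where "w = y powr \<delta>"
  have d: "real d \<ge> 1" and yq: "y ^ q \<ge> 1" using assms by auto
  have X: "X \<ge> 1" using n d yq assms(2) by (simp add: X_def)
  have w: "w > 0" using assms by (simp add: w_def)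
  have wp: "w ^ k = (y ^ k) powr \<delta>" for k
  proof -
    have "w ^ k = w powr real k" "y ^ k = y powr real k"
      using w assms by (simp_all add: powr_realpow)
    then show ?thesis by (simp add: w_def powr_powr mult.commute)
  qed
  have "log y X \<ge> 0" using X assms by simp
  then have r: "real r \<le> log y X" "log y X \<le> real (r + 1)" unfolding r_def by linarith+
  have "y ^ r \<le> X" using r(1) X assms le_log_iff[of y X "real r"] by (simp add: powr_realpow)
  then have "real d * y ^ r \<le> real d * X" using d by simp
  also have "real d * X = real n / (real d * y ^ q)"
    using d yq by (simp add: X_def power2_eq_square)
  finally have *: "real d * y ^ r \<le> real n / (real d * y ^ q)" .
  have "X \<le> y ^ (r + 1)"
    using r(2) X assms log_le_iff[of y X "real (r + 1)"] powr_realpow[of y "r + 1"] by simp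
  moreover have "real n powr (1/2) / real d / y ^ q \<le> X"
  proof -
    have "real d ^ 2 \<le> real d ^ 2 * y ^ q" using yq d by simp
    then have "real d \<le> sqrt (real n)" using n by (intro real_le_rsqrt) linarith
    then have "real d * sqrt (real n) \<le> sqrt (real n) * sqrt (real n)"
      by (intro mult_right_mono) auto
    then have "sqrt (real n) \<le> real n / real d"
      using d by (simp add: field_simps)
    then have "sqrt (real n) / (real d * y ^ q) \<le> real n / real d / (real d * y ^ q)"
      using d yq assms by (intro divide_right_mono) auto
    then show ?thesis by (simp add: X_def powr_half_sqrt power2_eq_square mult_ac)
  qed
  ultimately have "real n powr (1/2) / real d / y ^ q \<le> y ^ (r + 1)" by simp
  then have "(real n powr (1/2) / real d / y ^ q) powr \<delta> \<le> (y ^ (r + 1)) powr \<delta>"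
    using assms yq by (intro powr_mono2) auto
  then have "real n powr (\<delta> / 2) / real d powr \<delta> / w ^ q \<le> w ^ (r + 1)"
    unfolding wp using assms yq by (simp add: powr_divide powr_mult powr_powr mult.commute)
  then have "real n powr (\<delta> / 2) \<le> w ^ (r + 1) * w ^ q * real d powr \<delta>"
    using w d by (simp add: pos_divide_le_eq mult_ac)
  moreover have "real n > 0" using n d yq by (cases n) (auto simp: mult_le_0_iff)
  ultimately have "1 / w ^ r \<le> w ^ (q + 1) * real n powr (- \<delta> / 2) * real d powr \<delta>"
    using w d by (simp add: powr_minus field_simps)
  with * that show ?thesis unfolding w_def by blast
qed

lemma sum_rough_bound_rankin:
  fixes f :: "nat \<Rightarrow> nat \<Rightarrow> real"
  assumes "i \<ge> 1" "d \<ge> 1" "real i \<le> y" "y > 1" "0 < \<delta>" and n: "real d ^ 2 * y ^ q \<le> real n"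
    and fB: "\<And>t. t \<in> {i*d..<(i+1)*d} \<Longrightarrow> \<bar>f d t\<bar> \<le> B"
  shows "\<bar>(\<Sum>m | m > 0 \<and> (\<forall>p. prime p \<longrightarrow> p dvd m \<longrightarrow> i < p) \<and> n div (m * d) = i. f d (n div m))
      - real n * Cf_term f i d\<bar>
    \<le> B * real n * ((y powr \<delta>) ^ (q + 1) * real n powr (- \<delta> / 2)
        * (\<Prod>p\<in>primes_le y. 1 + y powr \<delta> / real p) / (real i * (real i + 1)) + 1 / y ^ q)
        * real d powr (\<delta> - 1)"
proof -
  define U where "U = (\<Prod>p\<in>primes_le y. 1 + y powr \<delta> / real p)"
  define W where "W = (y powr \<delta>) ^ (q + 1) * real n powr (- \<delta> / 2)"
  define I where "I = real i * (real i + 1)"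
  have U: "U \<ge> 0" unfolding U_def by (intro prod_nonneg) auto
  have B: "B \<ge> 0" using fB[of "i * d"] assms(2) by fastforce
  obtain r where r: "real d * y ^ r \<le> real n / (real d * y ^ q)"
    "1 / (y powr \<delta>) ^ r \<le> W * real d powr \<delta>"
    using exists_sieve_level[OF assms(2,4,5) n] unfolding W_def by blast
  have dp: "real d powr (\<delta> - 1) = real d powr \<delta> / real d"
    using assms by (simp add: powr_diff)
  have "1 \<le> real d powr \<delta>" using assms by (simp add: ge_one_powr_ge_zero)
  have "real n / (real i * (real i + 1) * real d) * U * (1 / (y powr \<delta>) ^ r) + real d * y ^ r
     \<le> real n / (real i * (real i + 1) * real d) * U * (W * real d powr \<delta>) + real n / (real d * y ^ q)"
    using U r by (intro add_mono mult_left_mono) auto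
  also have "real n / (real d * y ^ q) = real n / (real d * y ^ q) * 1" by simp
  \<comment> \<open>As d^\<delta> is at least 1, the remainder can carry this factor too; both
    errors are then summed over d by the same Rankin sum.\<close>
  also have "\<dots> \<le> real n / (real d * y ^ q) * real d powr \<delta>"
    using \<open>1 \<le> real d powr \<delta>\<close> assms(4) by (intro mult_left_mono) auto
  also have "real n / (real i * (real i + 1) * real d) * U * (W * real d powr \<delta>)
      + real n / (real d * y ^ q) * real d powr \<delta>
    = real n * (W * U / (real i * (real i + 1)) + 1 / y ^ q) * real d powr (\<delta> - 1)"
    unfolding dp I_def[symmetric] by (simp add: divide_inverse algebra_simps)
  finally have "real n / (real i * (real i + 1) * real d) * U * (1 / (y powr \<delta>) ^ r) + real d * y ^ r
    \<le> real n * (W * U / (real i * (real i + 1)) + 1 / y ^ q) * real d powr (\<delta> - 1)"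
    by simp
  then have "B * (real n / (real i * (real i + 1) * real d) * U * (1 / (y powr \<delta>) ^ r) + real d * y ^ r)
    \<le> B * (real n * (W * U / (real i * (real i + 1)) + 1 / y ^ q) * real d powr (\<delta> - 1))"
    using B by (rule mult_left_mono)
  moreover have "y powr \<delta> > 0" using assms by simp
  ultimately show ?thesis
    using sum_rough_bound[where f = f and B = B, OF assms(1-3) _ fB, of "y powr \<delta>" n r]
    unfolding U_def[symmetric] W_def[symmetric] by (simp add: mult.assoc)
qed

text \<open>Rankin's trick: \<open>real d ^ 2 * y ^ q / real n\<close> exceeds 1, hence so does its
  power \<delta>/2. That costs only \<open>(y ^ q) powr (\<delta> / 2)\<close>; it is enlarged to
  \<open>w ^ (q + 1)\<close> so that large d carry the same weight as in the sieve estimate.\<close>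

lemma rankin_weight:
  assumes "d \<ge> 1" "n \<ge> 1" "y > 1" "0 < \<delta>" and n: "real n < real d ^ 2 * y ^ q"
  shows "1 / real d \<le> (y powr \<delta>) ^ (q + 1) * real n powr (- \<delta> / 2) * real d powr (\<delta> - 1)"
proof -
  define w where "w = y powr \<delta>"
  have w: "w \<ge> 1" using assms by (simp add: w_def ge_one_powr_ge_zero)
  have yq: "y ^ q \<ge> 1" using assms by simp
  have wq: "w ^ q = (y ^ q) powr \<delta>"
  proof -
    have "w ^ q = w powr real q" "y ^ q = y powr real q"
      using w assms by (simp_all add: powr_realpow)
    then show ?thesis by (simp add: w_def powr_powr mult.commute)
  qed
  have "real n powr (\<delta> / 2) \<le> (real d ^ 2 * y ^ q) powr (\<delta> / 2)"
    using n assms by (intro powr_mono2) auto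
  also have "\<dots> = real d powr \<delta> * (y ^ q) powr (\<delta> / 2)"
  proof -
    have "real d ^ 2 = real d powr 2" using assms by simp
    then have "(real d ^ 2) powr (\<delta> / 2) = real d powr \<delta>" by (simp only: powr_powr) simp
    then show ?thesis using assms yq by (simp add: powr_mult)
  qed
  also have "\<dots> \<le> real d powr \<delta> * w ^ q"
    unfolding wq using yq assms by (intro mult_left_mono powr_mono) auto
  also have "\<dots> \<le> real d powr \<delta> * w ^ (q + 1)"
    using w by (intro mult_left_mono power_increasing) auto
  finally have "real n powr (\<delta> / 2) \<le> real d powr \<delta> * w ^ (q + 1)" .
  then have "1 \<le> w ^ (q + 1) * real n powr (- \<delta> / 2) * real d powr \<delta>"
    using assms by (simp add: powr_minus field_simps)
  then have "1 / real d \<le> w ^ (q + 1) * real n powr (- \<delta> / 2) * real d powr \<delta> / real d"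
    by (rule divide_right_mono) simp
  also have "\<dots> = w ^ (q + 1) * real n powr (- \<delta> / 2) * real d powr (\<delta> - 1)"
    using assms by (simp add: powr_diff)
  finally show ?thesis by (simp add: w_def)
qed

text \<open>Pairs with d^2 * y^q at most n are sieved, and large d in the series are bounded by
  Rankin; in \<open>1 + U\<close> the sieve gives \<open>U\<close> and the tail of the series gives
  1. The number of pairs with large d is left unevaluated, because it is estimated better for a
  whole block of quotients at once.\<close>

lemma sum_quotient_error:
  fixes f :: "nat \<Rightarrow> nat \<Rightarrow> real"
  assumes dep: "depends_only_on_component D_edge f \<or> depends_only_on_component L_edge f"
    and "n \<ge> 1" "i \<ge> 1" "real i \<le> y" "y > 1" "0 < \<delta>"
    and fB: "\<And>d t. d \<ge> 1 \<Longrightarrow> t \<in> {i*d..<(i+1)*d} \<Longrightarrow> \<bar>f d t\<bar> \<le> B"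
    and Z: "\<And>X. finite X \<Longrightarrow> X \<subseteq> smooth_numbers (primes_le y) \<Longrightarrow> (\<Sum>d\<in>X. real d powr (\<delta> - 1)) \<le> Z"
    and U: "U = (\<Prod>p\<in>primes_le y. 1 + y powr \<delta> / real p)"
    and W: "W = (y powr \<delta>) ^ (q + 1) * real n powr (- \<delta> / 2)"
  shows "\<bar>(\<Sum>a | a \<in> {1..n} \<and> n div a = i. f a n)
        - real n * infsum (Cf_term f i) (smooth_numbers (primes_le (real i)))\<bar>
    \<le> B * real (card {(d, m) \<in> factored_pairs n i. real n < real d ^ 2 * y ^ q})
      + B * real n * Z * (W * (1 + U) / (real i * (real i + 1)) + 1 / y ^ q)"
proof -
  define S where "S = smooth_numbers (primes_le (real i))"
  define G where "G = {d \<in> S. real d ^ 2 * y ^ q \<le> real n}"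
  define P where "P = factored_pairs n i"
  define Bad where "Bad = {(d, m) \<in> P. real n < real d ^ 2 * y ^ q}"
  define g where "g = (\<lambda>(d, m). f d (n div m))"
  define M where "M d = {m. m > 0 \<and> (\<forall>p. prime p \<longrightarrow> p dvd m \<longrightarrow> i < p) \<and> n div (m * d) = i}" for d
  define I where "I = real i * (real i + 1)"
  have B: "B \<ge> 0" using fB[of 1 i] by fastforce
  have I: "I > 0" using assms by (simp add: I_def)
  have W0: "W \<ge> 0" by (simp add: W)
  have Sy: "S \<subseteq> smooth_numbers (primes_le y)"
    unfolding S_def using assms by (intro smooth_numbers_mono primes_le_mono)
  have S1: "d \<ge> 1" if "d \<in> S" for d using that by (simp add: S_def smooth_numbers_def)
  have finP: "finite P" unfolding P_def by (rule finite_factored_pairs[OF \<open>i \<ge> 1\<close>])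
  have finG: "finite G"
  proof (rule finite_subset)
    show "G \<subseteq> {..n}"
    proof
      fix d assume d: "d \<in> G"
      then have "d \<ge> 1" using S1 by (simp add: G_def)
      then have "real d * 1 \<le> real d * (real d * y ^ q)"
        using assms one_le_power[of y q] mult_mono[of 1 "real d" 1 "y ^ q"] by (intro mult_left_mono) auto
      also have "\<dots> \<le> real n" using d by (simp add: G_def power2_eq_square mult.assoc)
      finally show "d \<in> {..n}" by simp
    qed
  qed auto
  have split: "P = Sigma G M \<union> Bad" "Sigma G M \<inter> Bad = {}"
    by (auto simp: P_def Bad_def G_def M_def S_def factored_pairs_def)
  have finM: "finite (M d)" if "d \<in> G" for d
  proof (rule finite_subset)
    show "M d \<subseteq> snd ` P" using that unfolding split(1) by force
  qed (use finP in simp)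
  have "(\<Sum>a | a \<in> {1..n} \<and> n div a = i. f a n) = sum g P"
    unfolding g_def P_def by (rule sum_factored_pairs[OF dep \<open>i \<ge> 1\<close>])
  also have "\<dots> = sum g (Sigma G M) + sum g Bad"
    using finP split by (metis finite_Un sum.union_disjoint)
  also have "sum g (Sigma G M) = (\<Sum>d\<in>G. \<Sum>m\<in>M d. f d (n div m))"
    unfolding g_def using finG finM by (intro sum.Sigma[symmetric]) auto
  finally have lhs: "(\<Sum>a | a \<in> {1..n} \<and> n div a = i. f a n)
      = (\<Sum>d\<in>G. \<Sum>m\<in>M d. f d (n div m)) + sum g Bad" .
  have bad: "\<bar>sum g Bad\<bar> \<le> B * real (card Bad)"
  proof -
    have "\<bar>g x\<bar> \<le> B" if "x \<in> Bad" for x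
    proof -
      obtain d m where x: "x = (d, m)" by (cases x)
      with that have "d \<ge> 1" "n div (m * d) = i"
        by (auto simp: Bad_def P_def factored_pairs_def smooth_numbers_def)
      then show ?thesis using fB div_mult_eq_iff by (simp add: x g_def)
    qed
    then show ?thesis using sum_norm_bound[of Bad g B] by (simp add: mult.commute)
  qed
  have summable: "Cf_term f i summable_on S"
    unfolding S_def by (rule Cf_term_summable(1)[where f = f and B = B, OF \<open>i \<ge> 1\<close> fB])
  have "infsum (Cf_term f i) S = infsum (Cf_term f i) (G \<union> (S - G))"
    by (rule arg_cong[of _ _ "infsum _"]) (auto simp: G_def)
  also have "\<dots> = infsum (Cf_term f i) G + infsum (Cf_term f i) (S - G)"
    using finG summable_on_subset_banach[OF summable, of "S - G"]
    by (intro infsum_Un_disjoint) auto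
  finally have inf: "infsum (Cf_term f i) S = (\<Sum>d\<in>G. Cf_term f i d) + infsum (Cf_term f i) (S - G)"
    using finG by simp
  have tail: "\<bar>infsum (Cf_term f i) (S - G)\<bar> \<le> B / I * W * Z"
  proof (rule summable_on_of_bounded_abs_sums)
    fix F assume F: "finite F" "F \<subseteq> S - G"
    have "(\<Sum>d\<in>F. \<bar>Cf_term f i d\<bar>) \<le> (\<Sum>d\<in>F. B / I * W * real d powr (\<delta> - 1))"
    proof (rule sum_mono)
      fix d assume d: "d \<in> F"
      then have d1: "d \<ge> 1" and big: "real n < real d ^ 2 * y ^ q"
        using F S1 by (auto simp: G_def)
      have "\<bar>Cf_term f i d\<bar> \<le> B * (\<Prod>p\<in>{p. prime p \<and> p \<le> i}. (real p - 1) / real p) / I * (1 / real d)"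
        unfolding I_def by (rule abs_Cf_term_le[where f = f and B = B, OF \<open>i \<ge> 1\<close> d1 fB[OF d1]])
      \<comment> \<open>For large d no cancellation against an Euler product is sought: the product
        of (p - 1)/p is bounded by 1.\<close>
      also have "\<dots> \<le> B * 1 / I * (W * real d powr (\<delta> - 1))"
        using rankin_weight[OF d1 \<open>n \<ge> 1\<close> \<open>y > 1\<close> \<open>0 < \<delta>\<close> big] B I
          prod_one_minus_inverse_primes_bounds[of i]
        unfolding W by (intro mult_mono divide_right_mono mult_left_mono) auto
      finally show "\<bar>Cf_term f i d\<bar> \<le> B / I * W * real d powr (\<delta> - 1)" by (simp add: mult.assoc)
    qed
    also have "\<dots> = B / I * W * (\<Sum>d\<in>F. real d powr (\<delta> - 1))" by (rule sum_distrib_left[symmetric])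
    also have "\<dots> \<le> B / I * W * Z"
      using F Sy B I W0 by (intro mult_left_mono Z) auto
    finally show "(\<Sum>d\<in>F. \<bar>Cf_term f i d\<bar>) \<le> B / I * W * Z" .
  qed
  define K where "K = B * real n * (W * U / I + 1 / y ^ q)"
  have U0: "U \<ge> 0" unfolding U by (intro prod_nonneg) auto
  have K: "K \<ge> 0" using B I W0 U0 assms by (simp add: K_def)
  have "\<bar>\<Sum>d\<in>G. (\<Sum>m\<in>M d. f d (n div m)) - real n * Cf_term f i d\<bar> \<le> (\<Sum>d\<in>G. K * real d powr (\<delta> - 1))"
  proof (rule order_trans[OF sum_abs sum_mono])
    fix d assume "d \<in> G"
    then have d: "d \<ge> 1" "real d ^ 2 * y ^ q \<le> real n" using S1 by (auto simp: G_def)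
    show "\<bar>(\<Sum>m\<in>M d. f d (n div m)) - real n * Cf_term f i d\<bar> \<le> K * real d powr (\<delta> - 1)"
      unfolding K_def I_def M_def W U
      by (rule sum_rough_bound_rankin[where f = f and B = B, OF \<open>i \<ge> 1\<close> d(1) \<open>real i \<le> y\<close> \<open>y > 1\<close> \<open>0 < \<delta>\<close> d(2) fB[OF d(1)]])
  qed
  also have "\<dots> = K * (\<Sum>d\<in>G. real d powr (\<delta> - 1))" by (rule sum_distrib_left[symmetric])
  also have "\<dots> \<le> K * Z"
    using finG Sy K by (intro mult_left_mono Z) (auto simp: G_def)
  finally have main: "\<bar>(\<Sum>d\<in>G. \<Sum>m\<in>M d. f d (n div m)) - real n * (\<Sum>d\<in>G. Cf_term f i d)\<bar> \<le> K * Z"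
    by (simp add: sum_subtractf sum_distrib_left)
  have "\<bar>real n * infsum (Cf_term f i) (S - G)\<bar> \<le> real n * (B / I * W * Z)"
    using mult_left_mono[OF tail of_nat_0_le_iff[of n]] by (simp only: abs_mult abs_of_nat)
  then have "\<bar>(\<Sum>a | a \<in> {1..n} \<and> n div a = i. f a n) - real n * infsum (Cf_term f i) S\<bar>
     \<le> B * real (card Bad) + (K * Z + real n * (B / I * W * Z))"
    using main bad unfolding lhs inf distrib_left by linarith
  also have "K * Z + real n * (B / I * W * Z) = B * real n * Z * (W * (1 + U) / I + 1 / y ^ q)"
    using I by (simp add: K_def divide_inverse algebra_simps)
  finally show ?thesis unfolding S_def Bad_def P_def I_def .
qed

text \<open>A pair determines its quotient, so the sets for different i are disjoint. For each d it
  therefore suffices to count once all m up to \<open>n / (y0 * d)\<close>, and Rankin's weight then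
  handles the sum of 1/d. This is how these pairs gain the factor \<open>1 / y0\<close>.\<close>

lemma sum_card_bad_pairs:
  assumes "n \<ge> 1" "y0 \<ge> 1" "y > 1" "0 < \<delta>" "finite F"
    and F: "\<And>i. i \<in> F \<Longrightarrow> y0 \<le> real i \<and> real i \<le> y"
    and Z: "\<And>X. finite X \<Longrightarrow> X \<subseteq> smooth_numbers (primes_le y) \<Longrightarrow> (\<Sum>d\<in>X. real d powr (\<delta> - 1)) \<le> Z"
    and W: "W = (y powr \<delta>) ^ (q + 1) * real n powr (- \<delta> / 2)"
  shows "(\<Sum>i\<in>F. real (card {(d, m) \<in> factored_pairs n i. real n < real d ^ 2 * y ^ q}))
    \<le> real n / y0 * W * Z"
proof -
  define Bad where "Bad i = {(d, m) \<in> factored_pairs n i. real n < real d ^ 2 * y ^ q}" for i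
  define X where "X = {d \<in> smooth_numbers (primes_le y). d \<le> n \<and> real n < real d ^ 2 * y ^ q}"
  have F1: "i \<ge> 1" if "i \<in> F" for i using F[OF that] assms(2) by linarith
  have finB: "finite (Bad i)" if "i \<in> F" for i
    by (rule finite_subset[OF _ finite_factored_pairs[OF F1[OF that], of n]]) (auto simp: Bad_def)
  have finX: "finite X" by (rule finite_subset[of _ "{..n}"]) (auto simp: X_def)
  have sub: "(\<Union>i\<in>F. Bad i) \<subseteq> Sigma X (\<lambda>d. {1..nat \<lfloor>real n / (y0 * real d)\<rfloor>})"
  proof (rule subsetI, clarify)
    fix d m i assume i: "i \<in> F" and dm: "(d, m) \<in> Bad i"
    then have d: "d \<in> smooth_numbers (primes_le (real i))" "d > 0" "m > 0" "n div (m * d) = i"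
      "real n < real d ^ 2 * y ^ q"
      by (auto simp: Bad_def factored_pairs_def smooth_numbers_def)
    then have le: "i * (m * d) \<le> n" using div_times_less_eq_dividend by blast
    moreover have "1 * (1 * d) \<le> i * (m * d)" using F1[OF i] d by (intro mult_le_mono) auto
    ultimately have "d \<le> n" by linarith
    have "y0 * (real m * real d) \<le> real i * (real m * real d)"
      using F[OF i] by (intro mult_right_mono) auto
    also have "\<dots> = real (i * (m * d))" by simp
    also have "\<dots> \<le> real n" using le by (rule of_nat_mono)
    finally have "real m \<le> real n / (y0 * real d)"
      using assms(2) d by (simp add: pos_le_divide_eq mult_ac)
    then have "m \<le> nat \<lfloor>real n / (y0 * real d)\<rfloor>" by (rule le_nat_floor)
    moreover have "d \<in> smooth_numbers (primes_le y)"
      using d(1) smooth_numbers_mono[OF primes_le_mono] F[OF i] by blast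
    ultimately show "d \<in> X \<and> m \<in> {1..nat \<lfloor>real n / (y0 * real d)\<rfloor>}"
      using d \<open>d \<le> n\<close> by (auto simp: X_def)
  qed
  have "(\<Sum>i\<in>F. card (Bad i)) = card (\<Union>i\<in>F. Bad i)"
    by (rule card_UN_disjoint[symmetric])
      (use assms finB in \<open>auto simp: Bad_def factored_pairs_def\<close>)
  also have "\<dots> \<le> card (Sigma X (\<lambda>d. {1..nat \<lfloor>real n / (y0 * real d)\<rfloor>}))"
    using sub finX by (intro card_mono) auto
  also have "\<dots> = (\<Sum>d\<in>X. nat \<lfloor>real n / (y0 * real d)\<rfloor>)"
    using finX by (subst card_SigmaI) auto
  finally have "real (\<Sum>i\<in>F. card (Bad i)) \<le> real (\<Sum>d\<in>X. nat \<lfloor>real n / (y0 * real d)\<rfloor>)"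
    by (rule of_nat_mono)
  then have "(\<Sum>i\<in>F. real (card (Bad i))) \<le> (\<Sum>d\<in>X. real (nat \<lfloor>real n / (y0 * real d)\<rfloor>))"
    by simp
  also have "\<dots> \<le> (\<Sum>d\<in>X. real n / y0 * W * real d powr (\<delta> - 1))"
  proof (rule sum_mono)
    fix d assume "d \<in> X"
    then have d: "d \<ge> 1" "real n < real d ^ 2 * y ^ q"
      by (auto simp: X_def smooth_numbers_def)
    have "real (nat \<lfloor>real n / (y0 * real d)\<rfloor>) \<le> real n / y0 * (1 / real d)"
      using assms(2) by simp
    also have "\<dots> \<le> real n / y0 * (W * real d powr (\<delta> - 1))"
      unfolding W using assms(2) rankin_weight[OF d(1) \<open>n \<ge> 1\<close> \<open>y > 1\<close> \<open>0 < \<delta>\<close> d(2)]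
      by (intro mult_left_mono) auto
    finally show "real (nat \<lfloor>real n / (y0 * real d)\<rfloor>) \<le> real n / y0 * W * real d powr (\<delta> - 1)"
      by (simp add: mult.assoc)
  qed
  also have "\<dots> = real n / y0 * W * (\<Sum>d\<in>X. real d powr (\<delta> - 1))"
    by (rule sum_distrib_left[symmetric])
  also have "\<dots> \<le> real n / y0 * W * Z"
    using finX assms(2) by (intro mult_left_mono Z) (auto simp: X_def W)
  finally show ?thesis by (simp add: Bad_def)
qed

lemma sum_inverse_successive_le:
  assumes "finite F" "y0 \<ge> 1" "\<And>i. i \<in> F \<Longrightarrow> y0 \<le> real i"
  shows "(\<Sum>i\<in>F. 1 / (real i * (real i + 1))) \<le> 1 / y0"
proof -
  define k where "k = nat \<lceil>y0\<rceil>"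
  obtain L where L: "\<forall>i\<in>F. i < L" using assms(1) unfolding finite_nat_set_iff_bounded by blast
  have k: "k \<ge> 1" "y0 \<le> real k" using assms(2) unfolding k_def by linarith+
  have "k \<le> i" if "i \<in> F" for i using assms(3)[OF that] unfolding k_def by linarith
  then have "(\<Sum>i\<in>F. 1 / (real i * (real i + 1))) \<le> (\<Sum>i\<in>{k..<k+L}. 1 / (real i * (real i + 1)))"
    using L by (intro sum_mono2) (auto simp: trans_less_add2)
  also have "\<dots> = 1 / real k - 1 / real (k + L)" using k by (intro sum_inverse_successive) auto
  also have "\<dots> \<le> 1 / real k" by simp
  also have "\<dots> \<le> 1 / y0" using k assms(2) by (intro divide_left_mono) auto
  finally show ?thesis .
qed

text \<open>In \<open>2 + U\<close> the pairs with large d and the tails of the inner series each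
  account for a 1, the sieve for \<open>U\<close>; all three gain \<open>1 / y0\<close>. The sieve
  remainder is paid once for each of the at most y quotients, whence
  \<open>y / y ^ q\<close>.\<close>

lemma block_error:
  fixes f :: "nat \<Rightarrow> nat \<Rightarrow> real"
  assumes dep: "depends_only_on_component D_edge f \<or> depends_only_on_component L_edge f"
    and "n \<ge> 1" "y0 \<ge> 1" "y > 1" "0 < \<delta>" "finite F"
    and F: "\<And>i. i \<in> F \<Longrightarrow> y0 \<le> real i \<and> real i \<le> y"
    and fB: "\<And>i d t. i \<in> F \<Longrightarrow> d \<ge> 1 \<Longrightarrow> t \<in> {i*d..<(i+1)*d} \<Longrightarrow> \<bar>f d t\<bar> \<le> B" and B: "B \<ge> 0"
    and Z: "\<And>X. finite X \<Longrightarrow> X \<subseteq> smooth_numbers (primes_le y) \<Longrightarrow> (\<Sum>d\<in>X. real d powr (\<delta> - 1)) \<le> Z"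
    and U: "U = (\<Prod>p\<in>primes_le y. 1 + y powr \<delta> / real p)"
    and W: "W = (y powr \<delta>) ^ (q + 1) * real n powr (- \<delta> / 2)"
  shows "(\<Sum>i\<in>F. \<bar>(\<Sum>a | a \<in> {1..n} \<and> n div a = i. f a n)
        - real n * infsum (Cf_term f i) (smooth_numbers (primes_le (real i)))\<bar>)
    \<le> B * real n * Z * (W * (2 + U) / y0 + y / y ^ q)"
proof -
  define Bad where "Bad i = real (card {(d, m) \<in> factored_pairs n i. real n < real d ^ 2 * y ^ q})" for i
  have F1: "i \<ge> 1" if "i \<in> F" for i using F[OF that] assms(3) by linarith
  have Z0: "Z \<ge> 0" using Z[of "{}"] by simp
  have W0: "W \<ge> 0" by (simp add: W)
  have U0: "U \<ge> 0" unfolding U by (intro prod_nonneg) auto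
  have cardF: "real (card F) \<le> y"
  proof -
    have "i \<in> {1..nat \<lfloor>y\<rfloor>}" if "i \<in> F" for i
      using F1[OF that] F[OF that] by (auto intro: le_nat_floor)
    then have "card F \<le> card {1..nat \<lfloor>y\<rfloor>}" by (intro card_mono) auto
    then show ?thesis using assms(4) by simp linarith
  qed
  have "(\<Sum>i\<in>F. \<bar>(\<Sum>a | a \<in> {1..n} \<and> n div a = i. f a n)
        - real n * infsum (Cf_term f i) (smooth_numbers (primes_le (real i)))\<bar>)
     \<le> (\<Sum>i\<in>F. B * Bad i + B * real n * Z * (W * (1 + U) / (real i * (real i + 1)) + 1 / y ^ q))"
    unfolding Bad_def
    by (intro sum_mono sum_quotient_error[where f = f and B = B, OF dep \<open>n \<ge> 1\<close> F1 conjunct2[OF F] \<open>y > 1\<close> \<open>0 < \<delta>\<close> fB Z U W])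
  also have "\<dots> = B * (\<Sum>i\<in>F. Bad i) + B * real n * Z * (W * (1 + U) * (\<Sum>i\<in>F. 1 / (real i * (real i + 1)))
      + real (card F) / y ^ q)"
    by (simp add: sum.distrib sum_distrib_left algebra_simps)
  also have "\<dots> \<le> B * (real n / y0 * W * Z) + B * real n * Z * (W * (1 + U) * (1 / y0) + y / y ^ q)"
    unfolding Bad_def
    using sum_card_bad_pairs[OF \<open>n \<ge> 1\<close> \<open>y0 \<ge> 1\<close> \<open>y > 1\<close> \<open>0 < \<delta>\<close> \<open>finite F\<close> F Z W]
      sum_inverse_successive_le[of F y0] F cardF assms(3,4) \<open>finite F\<close> B Z0 W0 U0
    by (intro add_mono mult_left_mono divide_right_mono mult_nonneg_nonneg) auto
  also have "\<dots> = B * real n * Z * (W * (2 + U) / y0 + y / y ^ q)"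
    by (simp add: divide_inverse algebra_simps)
  finally show ?thesis .
qed

section \<open>Choice of parameters\<close>

lemma euler_factor_le_exp:
  fixes x :: real
  assumes "0 \<le> x" "x \<le> 3 / 4"
  shows "1 / (1 - x) \<le> exp (4 * x)"
proof -
  have "1 \<le> 4 * (1 - x)" using assms by simp
  then have "x * 1 \<le> x * (4 * (1 - x))" using assms by (intro mult_left_mono) auto
  then have "1 \<le> (1 + 4 * x) * (1 - x)" by (simp add: algebra_simps)
  then have "1 / (1 - x) \<le> 1 + 4 * x" using assms by (simp add: pos_divide_le_eq)
  also have "\<dots> \<le> exp (4 * x)" by simp
  finally show ?thesis .
qed

text \<open>For \<delta> at most 1/2 even the factor of p = 2 stays away from its pole, since 1 /
  sqrt 2 is below 3/4. Each factor is then at most the exponential of four times its argument, and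
  p^\<delta> \<le> y^\<delta> leaves the sum of 1/p.\<close>

lemma euler_product_le_exp:
  fixes y \<delta> :: real
  assumes "y \<ge> 1" "0 < \<delta>" "\<delta> \<le> 1 / 2"
  shows "(\<Prod>p\<in>primes_le y. 1 / (1 - real p powr -(1 - \<delta>)))
    \<le> exp (4 * (y powr \<delta> * (\<Sum>p\<in>primes_le y. 1 / real p)))"
proof -
  have "(\<Prod>p\<in>primes_le y. 1 / (1 - real p powr -(1 - \<delta>)))
    \<le> (\<Prod>p\<in>primes_le y. exp (4 * (y powr \<delta> / real p)))"
  proof (rule prod_mono)
    fix p assume "p \<in> primes_le y"
    then have p: "real p \<ge> 2" "real p \<le> y"
      using prime_ge_2_nat[of p] by (auto simp: primes_le_def)
    have "sqrt (16 / 9) \<le> sqrt (2::real)" by (rule real_sqrt_le_mono) simp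
    then have sq: "4 / 3 \<le> sqrt (2::real)" by (simp add: real_sqrt_divide)
    have "real p powr -(1 - \<delta>) \<le> real p powr -(1/2)" using p assms by (intro powr_mono) auto
    also have "\<dots> \<le> 2 powr -(1/2)" using p by (intro powr_mono2') auto
    also have "\<dots> = 1 / sqrt 2" by (simp add: powr_minus powr_half_sqrt inverse_eq_divide)
    also have "\<dots> \<le> 3 / 4" using sq by (simp add: field_simps)
    finally have x: "real p powr -(1 - \<delta>) \<le> 3 / 4" .
    have "real p powr -(1 - \<delta>) = real p powr \<delta> / real p"
      using p powr_diff[of "real p" \<delta> 1] by simp
    also have "\<dots> \<le> y powr \<delta> / real p"
      using p assms by (intro divide_right_mono powr_mono2) auto
    finally have "exp (4 * real p powr -(1 - \<delta>)) \<le> exp (4 * (y powr \<delta> / real p))" by simp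
    with euler_factor_le_exp[OF powr_ge_zero x]
    have "1 / (1 - real p powr -(1 - \<delta>)) \<le> exp (4 * (y powr \<delta> / real p))"
      by (rule order_trans)
    then show "0 \<le> 1 / (1 - real p powr -(1 - \<delta>)) \<and> 1 / (1 - real p powr -(1 - \<delta>)) \<le> exp (4 * (y powr \<delta> / real p))"
      using x by simp
  qed
  also have "\<dots> = exp (4 * (y powr \<delta> * (\<Sum>p\<in>primes_le y. 1 / real p)))"
    by (simp add: sum_distrib_left flip: exp_sum)
  finally show ?thesis .
qed

lemma prod_one_plus_le_exp:
  fixes w y :: real
  assumes "w \<ge> 0"
  shows "(\<Prod>p\<in>primes_le y. 1 + w / real p) \<le> exp (w * (\<Sum>p\<in>primes_le y. 1 / real p))"
proof -
  have "(\<Prod>p\<in>primes_le y. 1 + w / real p) \<le> (\<Prod>p\<in>primes_le y. exp (w / real p))"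
    using assms by (intro prod_mono) auto
  also have "\<dots> = exp (w * (\<Sum>p\<in>primes_le y. 1 / real p))"
    by (simp add: sum_distrib_left flip: exp_sum)
  finally show ?thesis .
qed

lemma f_bound_on_block:
  fixes f :: "nat \<Rightarrow> nat \<Rightarrow> real"
  assumes bound: "\<And>a n. 1 \<le> a \<Longrightarrow> a \<le> n \<Longrightarrow> \<bar>f a n\<bar> \<le> C * (1 + ln (real n / real a))" and "C \<ge> 0"
    and "i \<ge> 1" "d \<ge> 1" "t \<in> {i*d..<(i+1)*d}"
  shows "\<bar>f d t\<bar> \<le> C * (1 + ln (real i + 1))"
proof -
  have "1 * d \<le> i * d" using assms(3) by (rule mult_le_mono1)
  moreover have "i * d \<le> t" using assms(5) by simp
  ultimately have "d \<le> t" by linarith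
  have "real t \<le> real ((i + 1) * d)" using assms(5) by (intro of_nat_mono) auto
  then have "real t / real d \<le> real i + 1" using assms(4) by (simp add: pos_divide_le_eq algebra_simps)
  then have "ln (real t / real d) \<le> ln (real i + 1)"
    using assms(4) \<open>d \<le> t\<close> by (subst ln_le_cancel_iff) auto
  then have "C * (1 + ln (real t / real d)) \<le> C * (1 + ln (real i + 1))"
    using \<open>C \<ge> 0\<close> by (intro mult_left_mono) auto
  with bound[OF assms(4) \<open>d \<le> t\<close>] show ?thesis by linarith
qed

text \<open>The loss of 3/K in the exponent is made up of 1/K for keeping 2 * \<theta> below 1, 1/K
  for the width of the block (the gain is \<open>1 / y0\<close>, while the primes go up to y), and
  1/K for the Euler products and logarithms gathered in \<open>H\<close>.\<close>

lemma block_error_asymp: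
  fixes f :: "nat \<Rightarrow> nat \<Rightarrow> real" and K j n :: nat
  defines "N \<equiv> ln (real n)" and "l \<equiv> ln (ln (real n))"
  defines "S \<equiv> sqrt (N * l)" and "\<theta> \<equiv> (1 - 1 / real K) / 2"
  assumes dep: "depends_only_on_component D_edge f \<or> depends_only_on_component L_edge f"
    and bound: "\<And>a n. 1 \<le> a \<Longrightarrow> a \<le> n \<Longrightarrow> \<bar>f a n\<bar> \<le> C * (1 + ln (real n / real a))" and C: "C \<ge> 0"
    and K: "K \<ge> 2" and j: "j < 2 * K"
    and l1: "l \<ge> 1" and SK: "S \<ge> real K" and Sl: "real K * l \<le> S"
    and H: "6 * C * (1 + S) * exp (5 * N powr \<theta> * (3 + 2 * ln (4 * S))) * (N powr \<theta>) ^ (2 * K + 2)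
      \<le> exp (S / real K)"
  shows "(\<Sum>i | exp (real j * S / real K) \<le> real i \<and> real i < exp (real (Suc j) * S / real K).
      \<bar>(\<Sum>a | a \<in> {1..n} \<and> n div a = i. f a n)
        - real n * infsum (Cf_term f i) (smooth_numbers (primes_le (real i)))\<bar>)
    \<le> 2 * real n * exp (- (1 - 3 / real K) * S)"
proof -
  define c where "c = real (Suc j) / real K"
  define y0 where "y0 = exp (real j * S / real K)"
  define y where "y = exp (c * S)"
  define \<delta> where "\<delta> = \<theta> * l / (c * S)"
  define w where "w = N powr \<theta>"
  \<comment> \<open>Large enough for the lowest block, where c = 1/K: there
    \<open>y / y ^ q = y powr (-2 * K)\<close> is still exp (-2 * S).\<close>
  define q where "q = 2 * K + 1"
  define F where "F = {i::nat. y0 \<le> real i \<and> real i < y}"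
  define E where "E = (\<Sum>p\<in>primes_le y. 1 / real p)"
  define U where "U = (\<Prod>p\<in>primes_le y. 1 + y powr \<delta> / real p)"
  define W where "W = (y powr \<delta>) ^ (q + 1) * real n powr (- \<delta> / 2)"
  define Z where "Z = (\<Prod>p\<in>primes_le y. 1 / (1 - real p powr -(1 - \<delta>)))"
  \<comment> \<open>Bounds \<open>C * (1 + ln (2 * y))\<close>, as ln 2 < 1 and ln y = c * S with c
    at most 2.\<close>
  define B where "B = C * (2 + 2 * S)"
  have S2: "S \<ge> 2" using SK K by linarith
  have N1: "N \<ge> 1"
  proof -
    \<comment> \<open>Positivity is drawn from the size of \<open>S\<close>: a nonpositive
      \<open>N\<close> would make the radicand nonpositive.\<close>
    have "N > 0"
    proof (rule ccontr)
      assume "\<not> N > 0"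
      then have "N * l \<le> 0" using l1 by (intro mult_nonpos_nonneg) auto
      then have "S \<le> 0" unfolding S_def by (rule real_sqrt_le_0_iff[THEN iffD2])
      then show False using S2 by simp
    qed
    then have "N = exp l" by (simp add: l_def N_def)
    then show ?thesis using l1 by simp
  qed
  then have "real n > 0" by (cases n) (auto simp: N_def)
  then have n: "n \<ge> 1" "real n = exp N" by (auto simp: N_def)
  have w: "w = exp (\<theta> * l)" using N1 by (simp add: w_def l_def N_def powr_def)
  have Kpos: "real K \<ge> 2" using K by simp
  have \<theta>: "\<theta> > 0" "\<theta> \<le> 1 / 2" using Kpos by (auto simp: \<theta>_def field_simps)
  have w1: "w \<ge> 1" using \<theta> l1 by (simp add: w)
  have SS: "S * S = N * l" using N1 l1 by (simp add: S_def)
  have c: "c > 0" "1 \<le> real K * c" "c \<le> 2"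
    using Kpos j by (auto simp: c_def field_simps)
  have cS: "1 \<le> c * S"
  proof -
    have "c * real K \<le> c * S" using c SK by (intro mult_left_mono) auto
    then show ?thesis using c(2) by (simp only: mult.commute[of c])
  qed
  have y2: "y \<ge> 2" using exp_ge_add_one_self[of "c * S"] cS unfolding y_def by linarith
  have yd: "y powr \<delta> = w"
    using c S2 by (simp add: y_def w \<delta>_def powr_def)
  have \<delta>: "\<delta> > 0" "\<delta> \<le> 1 / 2"
  proof -
    show "\<delta> > 0" using \<theta> l1 c S2 by (simp add: \<delta>_def)
    have "l \<le> real K * c * l" using c l1 by (simp add: mult_le_cancel_right)
    also have "\<dots> = c * (real K * l)" by simp
    also have "\<dots> \<le> c * S" using Sl c by (intro mult_left_mono) auto
    finally have "\<theta> * l \<le> 1 / 2 * (c * S)" using \<theta> l1 by (intro mult_mono) auto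
    then show "\<delta> \<le> 1 / 2" using cS unfolding \<delta>_def by (subst pos_divide_le_eq) auto
  qed
  have Fset: "{i::nat. exp (real j * S / real K) \<le> real i \<and> real i < exp (real (Suc j) * S / real K)} = F"
    by (simp add: F_def y0_def y_def c_def)
  have finF: "finite F"
    by (rule finite_subset[of _ "{..nat \<lfloor>y\<rfloor>}"]) (auto simp: F_def intro: le_nat_floor)
  have y01: "y0 \<ge> 1" using S2 by (simp add: y0_def)
  have E: "E \<le> 3 + 2 * ln (4 * S)" "E \<ge> 0"
  proof -
    have "E \<le> 3 + 2 * ln (2 * ln y)" unfolding E_def by (rule sum_inverse_primes_le[OF y2])
    also have "ln (2 * ln y) \<le> ln (4 * S)"
      using c cS S2 by (subst ln_le_cancel_iff) (auto simp: y_def)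
    finally show "E \<le> 3 + 2 * ln (4 * S)" by simp
    show "E \<ge> 0" unfolding E_def by (intro sum_nonneg) auto
  qed
  have B0: "B \<ge> 0" using C S2 by (simp add: B_def)
  have fB: "\<bar>f d t\<bar> \<le> B" if "i \<in> F" "d \<ge> 1" "t \<in> {i*d..<(i+1)*d}" for i d t
  proof -
    have i: "i \<ge> 1" "real i \<le> y" using that(1) y01 by (auto simp: F_def)
    have "ln (real i + 1) \<le> ln (2 * y)"
      using i y2 by (subst ln_le_cancel_iff) auto
    also have "\<dots> = ln 2 + c * S" by (simp add: ln_mult y_def)
    also have "\<dots> \<le> 1 + 2 * S" using c S2 ln_2_less_1 by (intro add_mono mult_right_mono) auto
    finally have "C * (1 + ln (real i + 1)) \<le> B" unfolding B_def using C by (intro mult_left_mono) auto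
    moreover have "\<bar>f d t\<bar> \<le> C * (1 + ln (real i + 1))"
      by (rule f_bound_on_block[OF bound C i(1) that(2,3)])
    ultimately show ?thesis by linarith
  qed
  have Z: "(\<Sum>d\<in>X. real d powr (\<delta> - 1)) \<le> Z" if "finite X" "X \<subseteq> smooth_numbers (primes_le y)" for X
    using sum_smooth_numbers_le[of "primes_le y" "1 - \<delta>" X] that \<delta> by (simp add: Z_def prime_primes_le)
  have "(\<Sum>i\<in>F. \<bar>(\<Sum>a | a \<in> {1..n} \<and> n div a = i. f a n)
        - real n * infsum (Cf_term f i) (smooth_numbers (primes_le (real i)))\<bar>)
      \<le> B * real n * Z * (W * (2 + U) / y0 + y / y ^ q)"
    by (rule block_error[OF dep n(1) y01 _ \<delta>(1) finF _ fB B0 Z U_def W_def]) (use y2 in \<open>auto simp: F_def\<close>)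
  also have "\<dots> \<le> B * real n * exp (4 * (w * E)) * (3 * exp (w * E) * W / y0 + 3 * exp (w * E) * (w ^ (q + 1) * (y / y ^ q)))"
  proof -
    have Z': "Z \<le> exp (4 * (w * E))"
      using euler_product_le_exp[of y \<delta>] y2 \<delta> unfolding Z_def E_def yd by simp
    have "U \<le> exp (w * E)"
      unfolding U_def E_def yd using w1 by (intro prod_one_plus_le_exp) auto
    moreover have e1: "1 \<le> exp (w * E)" using w1 E by simp
    ultimately have "2 + U \<le> 3 * exp (w * E)" by linarith
    then have "W * (2 + U) / y0 \<le> W * (3 * exp (w * E)) / y0"
      using y01 by (intro divide_right_mono mult_left_mono) (auto simp: W_def)
    \<comment> \<open>The remainder term is multiplied by quantities that are at least 1, so that
      both terms share the one factor controlled by \<open>H\<close>.\<close>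
    moreover have "1 * (1 * (y / y ^ q)) \<le> 3 * exp (w * E) * (w ^ (q + 1) * (y / y ^ q))"
    proof (intro mult_mono)
      show "1 \<le> 3 * exp (w * E)" using e1 by linarith
      show "1 \<le> w ^ (q + 1)" using w1 by (rule one_le_power)
    qed (use w1 y2 in auto)
    moreover have "U \<ge> 0" unfolding U_def by (intro prod_nonneg) auto
    ultimately have sum: "W * (2 + U) / y0 + y / y ^ q
        \<le> 3 * exp (w * E) * W / y0 + 3 * exp (w * E) * (w ^ (q + 1) * (y / y ^ q))"
      and "0 \<le> W * (2 + U) / y0 + y / y ^ q"
      using y01 y2 by (simp_all add: W_def mult_ac)
    moreover have "B * real n * Z \<le> B * real n * exp (4 * (w * E))"
      using Z' B0 by (intro mult_left_mono) auto
    moreover have "0 \<le> B * real n * exp (4 * (w * E))" using B0 by simp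
    ultimately show ?thesis by (intro mult_mono[of "B * real n * Z"])
  qed
  also have "\<dots> = real n * (3 * B * exp (5 * w * E) * w ^ (q + 1)) * (real n powr (- \<delta> / 2) / y0 + y / y ^ q)"
  proof -
    have "5 * w * E = 4 * (w * E) + w * E" by simp
    then have "exp (5 * w * E) = exp (4 * (w * E)) * exp (w * E)" by (simp only: exp_add)
    moreover have "b * m * e4 * (3 * e1 * (v * T) / y0 + 3 * e1 * (v * Y))
        = m * (3 * b * (e4 * e1) * v) * (T / y0 + Y)" for b m e4 e1 v T Y :: real
      by (simp add: divide_inverse algebra_simps)
    ultimately show ?thesis unfolding W_def yd by (simp only:)
  qed
  also have "\<dots> \<le> real n * exp (S / real K) * (exp (- (1 - 2 / real K) * S) + exp (- (1 - 2 / real K) * S))"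
  proof -
    have "exp (5 * w * E) \<le> exp (5 * w * (3 + 2 * ln (4 * S)))"
      using E w1 by simp
    then have "3 * B * exp (5 * w * E) * w ^ (q + 1)
        \<le> 3 * B * exp (5 * w * (3 + 2 * ln (4 * S))) * w ^ (q + 1)"
      using B0 w1 by (intro mult_right_mono mult_left_mono) auto
    \<comment> \<open>Here \<open>3 * B = 6 * C * (1 + S)\<close> and
      \<open>q + 1 = 2 * K + 2\<close>.\<close>
    also have "\<dots> \<le> exp (S / real K)"
      using H by (simp add: B_def q_def w_def algebra_simps)
    finally have 1: "3 * B * exp (5 * w * E) * w ^ (q + 1) \<le> exp (S / real K)" .
    have "real n powr (- \<delta> / 2) / y0 = exp (- (N * \<delta> / 2 + real j * S / real K))"
    proof -
      have "real n powr (- \<delta> / 2) = exp (- (N * \<delta> / 2))"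
        by (simp add: n(2) powr_def mult.commute)
      then show ?thesis by (simp only: y0_def minus_add_distrib exp_add exp_minus divide_inverse)
    qed
    moreover have "(1 - 2 / real K) * S \<le> N * \<delta> / 2 + real j * S / real K"
    proof -
      have "N * \<delta> / 2 = \<theta> / (2 * c) * (N * l / S)" by (simp add: \<delta>_def mult_ac)
      also have "N * l / S = S" using S2 by (simp flip: SS)
      finally have d: "N * \<delta> / 2 = \<theta> / (2 * c) * S" .
      \<comment> \<open>Equality holds at c = 1/2, so the quotients near exp (S/2) are the critical
        ones.\<close>
      have "0 \<le> (2 * c - 1) ^ 2 / (4 * c)" using c by simp
      then have "1 \<le> c + 1 / (4 * c)" using c by (simp add: power2_eq_square field_simps)
      then have "2 * \<theta> * 1 \<le> 2 * \<theta> * (c + 1 / (4 * c))" using \<theta> by (intro mult_left_mono) auto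
      also have "\<dots> = 2 * \<theta> * c + \<theta> / (2 * c)" using c by (simp add: field_simps)
      also have "2 * \<theta> * c \<le> 1 * c" using \<theta> c by (intro mult_right_mono) auto
      finally have "2 * \<theta> \<le> c + \<theta> / (2 * c)" by simp
      moreover have "c = real j / real K + 1 / real K" by (simp add: c_def add_divide_distrib)
      moreover have "2 * \<theta> = 1 - 1 / real K" by (simp add: \<theta>_def)
      ultimately have "1 - 2 / real K \<le> \<theta> / (2 * c) + real j / real K" by simp
      then have "(1 - 2 / real K) * S \<le> (\<theta> / (2 * c) + real j / real K) * S"
        using S2 by (intro mult_right_mono) auto
      then show ?thesis by (simp add: d algebra_simps)
    qed
    ultimately have 2: "real n powr (- \<delta> / 2) / y0 \<le> exp (- (1 - 2 / real K) * S)"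
      by (simp only: exp_le_cancel_iff mult_minus_left neg_le_iff_le)
    have "y / y ^ q = inverse (y ^ (2 * K))" using y2 by (simp add: q_def field_simps)
    also have "y ^ (2 * K) = exp (2 * (real K * c) * S)"
      by (simp add: y_def flip: exp_of_nat_mult)
    also have "inverse \<dots> = exp (- (2 * (real K * c) * S))" by (simp add: exp_minus)
    also have "\<dots> \<le> exp (- (1 - 2 / real K) * S)"
    proof -
      have "1 - 2 / real K \<le> 2 * (real K * c)" using c Kpos by (smt (verit) divide_nonneg_nonneg)
      then have "(1 - 2 / real K) * S \<le> 2 * (real K * c) * S" using S2 by (intro mult_right_mono) auto
      then show ?thesis by (simp only: exp_le_cancel_iff mult_minus_left neg_le_iff_le)
    qed
    finally have 3: "y / y ^ q \<le> exp (- (1 - 2 / real K) * S)" .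
    show ?thesis
      using y2 y01 by (intro mult_mono[OF mult_left_mono[OF 1] add_mono[OF 2 3]]) auto
  qed
  also have "\<dots> = 2 * real n * (exp (S / real K) * exp (- (1 - 2 / real K) * S))" by simp
  also have "exp (S / real K) * exp (- (1 - 2 / real K) * S) = exp (- (1 - 3 / real K) * S)"
    by (simp add: algebra_simps diff_divide_distrib flip: exp_add)
  finally show ?thesis unfolding Fset .
qed

section \<open>Assembling the blocks\<close>

text \<open>After taking logarithms, each of the three factors contributes o(sqrt (x * ln x)) and is
  allotted a third of \<kappa>. The middle one is where \<theta> < 1/2 is decisive.\<close>

lemma eventually_block_condition_real:
  fixes \<theta> C \<kappa> :: real
  assumes \<theta>: "0 < \<theta>" "\<theta> < 1 / 2" and C: "C > 0" and \<kappa>: "\<kappa> > 0"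
  shows "eventually (\<lambda>x. 6 * C * (1 + sqrt (x * ln x))
      * exp (5 * x powr \<theta> * (3 + 2 * ln (4 * sqrt (x * ln x)))) * (x powr \<theta>) ^ m
    \<le> exp (\<kappa> * sqrt (x * ln x))) at_top"
proof -
  have "((\<lambda>x. ln (6 * C * (1 + sqrt (x * ln x))) / sqrt (x * ln x)) \<longlongrightarrow> 0) at_top"
    using C by real_asymp
  moreover have "((\<lambda>x. 5 * x powr \<theta> * (3 + 2 * ln (4 * sqrt (x * ln x))) / sqrt (x * ln x)) \<longlongrightarrow> 0) at_top"
    using \<theta> by real_asymp
  moreover have "((\<lambda>x. real m * \<theta> * (ln x / sqrt (x * ln x))) \<longlongrightarrow> 0) at_top"
    by (rule tendsto_mult_right_zero) real_asymp
  ultimately have "eventually (\<lambda>x. ln (6 * C * (1 + sqrt (x * ln x))) / sqrt (x * ln x) < \<kappa> / 3) at_top"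
    "eventually (\<lambda>x. 5 * x powr \<theta> * (3 + 2 * ln (4 * sqrt (x * ln x))) / sqrt (x * ln x) < \<kappa> / 3) at_top"
    "eventually (\<lambda>x. real m * \<theta> * (ln x / sqrt (x * ln x)) < \<kappa> / 3) at_top"
    using \<kappa> by (auto dest!: order_tendstoD(2)[where a = "\<kappa> / 3"])
  moreover have "eventually (\<lambda>x::real. x > 1) at_top" by (rule eventually_gt_at_top)
  ultimately show ?thesis
  proof eventually_elim
    case (elim x)
    define S where "S = sqrt (x * ln x)"
    have S: "S > 0" using elim by (simp add: S_def)
    have "ln (6 * C * (1 + S)) \<le> \<kappa> / 3 * S" "5 * x powr \<theta> * (3 + 2 * ln (4 * S)) \<le> \<kappa> / 3 * S"
      "real m * \<theta> * ln x \<le> \<kappa> / 3 * S"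
      using elim S by (simp_all add: S_def[symmetric] pos_divide_less_eq less_imp_le)
    then have "ln (6 * C * (1 + S)) + 5 * x powr \<theta> * (3 + 2 * ln (4 * S)) + real m * \<theta> * ln x \<le> \<kappa> * S"
      by simp
    then have "exp (ln (6 * C * (1 + S)) + 5 * x powr \<theta> * (3 + 2 * ln (4 * S)) + real m * \<theta> * ln x) \<le> exp (\<kappa> * S)"
      by simp
    moreover have "6 * C * (1 + S) > 0" using C S by simp
    moreover have "(x powr \<theta>) ^ m = exp (real m * \<theta> * ln x)"
      using elim by (simp add: powr_def mult.assoc flip: exp_of_nat_mult)
    ultimately show ?case by (simp add: exp_add S_def[symmetric])
  qed
qed

lemma eventually_block_conditions:
  fixes K :: nat
  assumes K: "K \<ge> 2" and C: "C \<ge> 0"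
  defines "S \<equiv> \<lambda>n::nat. sqrt (ln (real n) * ln (ln (real n)))" and "\<theta> \<equiv> (1 - 1 / real K) / 2"
  shows "eventually (\<lambda>n. ln (ln (real n)) \<ge> 1 \<and> S n \<ge> real K \<and> real K * ln (ln (real n)) \<le> S n \<and>
    6 * C * (1 + S n) * exp (5 * ln (real n) powr \<theta> * (3 + 2 * ln (4 * S n)))
      * (ln (real n) powr \<theta>) ^ (2 * K + 2) \<le> exp (S n / real K)) at_top"
proof -
  have lim: "filterlim (\<lambda>n::nat. ln (real n)) at_top at_top" by real_asymp
  have "eventually (\<lambda>n. ln (ln (real n)) \<ge> 1) at_top"
    using filterlim_at_top[THEN iffD1, rule_format, of "\<lambda>n::nat. ln (ln (real n))" at_top 1]
    by (auto intro!: filterlim_compose[OF ln_at_top lim])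
  moreover have "eventually (\<lambda>n. S n \<ge> real K) at_top"
  proof -
    have "filterlim S at_top at_top" unfolding S_def by real_asymp
    then show ?thesis by (simp add: filterlim_at_top)
  qed
  moreover have "eventually (\<lambda>n. real K * ln (ln (real n)) \<le> S n) at_top"
  proof -
    have "((\<lambda>n. ln (ln (real n)) / S n) \<longlongrightarrow> 0) at_top" unfolding S_def by real_asymp
    moreover have "(0::real) < 1 / real K" using K by simp
    ultimately have "eventually (\<lambda>n. ln (ln (real n)) / S n < 1 / real K) at_top" by (rule order_tendstoD(2))
    with \<open>eventually (\<lambda>n. S n \<ge> real K) at_top\<close> show ?thesis
    proof eventually_elim
      case (elim n)
      then have "S n > 0" using K by linarith
      then show ?case using elim K by (simp add: field_simps)
    qed
  qed
  \<comment> \<open>\<open>C\<close> may be 0, whereas the asymptotic comparison takes the logarithm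
    of a positive constant; hence \<open>C + 1\<close>.\<close>
  moreover have "eventually (\<lambda>n. 6 * (C + 1) * (1 + S n) * exp (5 * ln (real n) powr \<theta> * (3 + 2 * ln (4 * S n)))
      * (ln (real n) powr \<theta>) ^ (2 * K + 2) \<le> exp (1 / real K * S n)) at_top"
    unfolding S_def
    by (rule eventually_compose_filterlim[OF eventually_block_condition_real lim])
      (use K C in \<open>auto simp: \<theta>_def field_simps\<close>)
  ultimately show ?thesis
  proof eventually_elim
    case (elim n)
    have "S n \<ge> 0" using elim(2) by linarith
    then have "6 * C * (1 + S n) * exp (5 * ln (real n) powr \<theta> * (3 + 2 * ln (4 * S n)))
        * (ln (real n) powr \<theta>) ^ (2 * K + 2)
      \<le> 6 * (C + 1) * (1 + S n) * exp (5 * ln (real n) powr \<theta> * (3 + 2 * ln (4 * S n)))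
        * (ln (real n) powr \<theta>) ^ (2 * K + 2)"
      by (intro mult_right_mono) auto
    also have "\<dots> \<le> exp (1 / real K * S n)" using elim by blast
    finally show ?case using elim(1-3) by simp
  qed
qed

section \<open>Large quotients and the tail of the outer series\<close>

lemma sum_inverse_sqrt_le: "(\<Sum>a=1..m. 1 / sqrt (real a)) \<le> 2 * sqrt (real m)"
proof (induction m)
  case (Suc m)
  define s t where "s = sqrt (real m)" and "t = sqrt (real (Suc m))"
  have t: "t > 0" "s \<le> t" "t * t = s * s + 1" by (auto simp: s_def t_def)
  have "0 \<le> (t - s) * (t - s)" by simp
  then have "1 + 2 * s * t \<le> 2 * t * t" using t(3) by (simp add: algebra_simps)
  then have "1 \<le> (2 * t - 2 * s) * t" by (simp add: algebra_simps)
  then have "1 / t \<le> 2 * t - 2 * s" using t(1) by (simp only: pos_divide_le_eq)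
  then show ?case using Suc by (simp add: s_def t_def)
qed simp

text \<open>With the logarithm replaced by a square root, the sum over large quotients and the tail
  of the outer series become elementary. Only the root of the cutoff is then saved, which is why
  quotients up to exp (2 * S) are treated in order to save exp (S).\<close>

lemma one_plus_ln_le_sqrt:
  fixes x :: real
  assumes "x > 0"
  shows "1 + ln x \<le> 2 * sqrt x"
proof -
  have "ln x = 2 * ln (sqrt x)" using assms by (simp add: ln_sqrt)
  also have "ln (sqrt x) \<le> sqrt x - 1" using assms by (intro ln_le_minus_one) auto
  finally show ?thesis by simp
qed

text \<open>A telescoping majorant gives convergence and an explicit tail bound together.\<close>

lemma tail_le_telescope:
  fixes h u :: "nat \<Rightarrow> real"
  assumes h: "\<And>k. \<bar>h k\<bar> \<le> u k - u (Suc k)" and u: "u \<longlonglongrightarrow> 0"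
  shows "summable h" and "\<bar>suminf h - (\<Sum>k<m. h k)\<bar> \<le> u m"
proof -
  have sums: "(\<lambda>k. u (k + j) - u (Suc (k + j))) sums u j" for j
    using telescope_sums'[of "\<lambda>k. u (k + j)" 0] LIMSEQ_ignore_initial_segment[OF u, of j] by simp
  show summable: "summable h"
    by (rule summable_comparison_test'[OF sums_summable[OF sums[of 0]]]) (use h in auto)
  have "suminf h - (\<Sum>k<m. h k) = (\<Sum>k. h (k + m))"
    using suminf_minus_initial_segment[OF summable, of m] by simp
  moreover have "norm (\<Sum>k. h (k + m)) \<le> (\<Sum>k. u (k + m) - u (Suc (k + m)))"
    by (rule norm_suminf_le[OF _ sums_summable[OF sums]]) (use h in auto)
  ultimately show "\<bar>suminf h - (\<Sum>k<m. h k)\<bar> \<le> u m"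
    using sums_unique[OF sums[of m]] by simp
qed

text \<open>With s and t the two roots, t \<le> 2 * s gives t - s = 1 / (t + s) \<ge> 1 / (3 * s);
  the constant 6 is 2 times this 3.\<close>

lemma sqrt_telescope_bound:
  fixes i :: nat
  assumes "i \<ge> 1"
  shows "2 * sqrt (real i + 1) / (real i * (real i + 1)) \<le> 6 / sqrt (real i) - 6 / sqrt (real i + 1)"
proof -
  define s t where "s = sqrt (real i)" and "t = sqrt (real i + 1)"
  have s: "s \<ge> 1" "t > 0" and st: "s * s = real i" "t * t = real i + 1"
    using assms by (auto simp: s_def t_def)
  have "t \<le> 2 * s"
  proof (rule power2_le_imp_le)
    show "t\<^sup>2 \<le> (2 * s)\<^sup>2" using st assms by (simp add: power2_eq_square)
  qed (use s in auto)
  have "2 * t / (s * s * (t * t)) = 2 / (s * s * t)" using s by simp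
  then have "2 * t / (real i * (real i + 1)) = 2 / (s * s * t)" by (simp only: st)
  also have "\<dots> \<le> 6 * (t - s) / (s * t)"
  proof -
    have "(t - s) * (t + s) = 1" using st by (simp add: algebra_simps)
    then have "1 \<le> (t - s) * (3 * s)"
      using \<open>t \<le> 2 * s\<close> st s mult_left_mono[of "t + s" "3 * s" "t - s"] real_sqrt_le_mono[of "real i" "real i + 1"]
      by (simp add: s_def t_def)
    then have "2 \<le> 6 * (t - s) * s" by (simp add: algebra_simps)
    then show ?thesis using s by (simp add: field_simps)
  qed
  also have "\<dots> = 6 / s - 6 / t" using s by (simp add: field_simps)
  finally show ?thesis by (simp add: s_def t_def)
qed

lemma sum_exp_blocks:
  fixes h :: "nat \<Rightarrow> real" and S :: real
  assumes "S \<ge> 0"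
  shows "(\<Sum>i | 1 \<le> i \<and> real i < exp (real k * S / real K). h i)
    = (\<Sum>j<k. \<Sum>i | exp (real j * S / real K) \<le> real i \<and> real i < exp (real (Suc j) * S / real K). h i)"
proof (induction k)
  case 0
  have "{i::nat. 1 \<le> i \<and> real i < exp (real 0 * S / real K)} = {}" by auto
  then show ?case by (simp only: sum.empty lessThan_0)
next
  case (Suc k)
  let ?A = "{i::nat. 1 \<le> i \<and> real i < exp (real k * S / real K)}"
  let ?B = "{i::nat. exp (real k * S / real K) \<le> real i \<and> real i < exp (real (Suc k) * S / real K)}"
  have fin: "finite {i::nat. real i < y}" for y
    by (rule finite_subset[of _ "{..nat \<lfloor>y\<rfloor>}"]) (auto intro: le_nat_floor)
  have "real k * S / real K \<le> real (Suc k) * S / real K"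
    using assms by (intro divide_right_mono mult_right_mono) auto
  then have le: "exp (real k * S / real K) \<le> exp (real (Suc k) * S / real K)" by simp
  have "1 \<le> exp (real k * S / real K)" using assms by simp
  then have "1 \<le> i" if "i \<in> ?B" for i using that by (cases i) auto
  then have "{i::nat. 1 \<le> i \<and> real i < exp (real (Suc k) * S / real K)} = ?A \<union> ?B"
    using le by (intro equalityI subsetI) (auto simp: not_less simp del: of_nat_Suc intro: less_le_trans[OF _ le])
  moreover have "?A \<inter> ?B = {}" by auto
  moreover have "finite ?A" "finite ?B" by (auto intro: finite_subset[OF _ fin])
  ultimately show ?case using Suc by (simp add: sum.union_disjoint del: of_nat_Suc)
qed

text \<open>The constant 10 is 4 + 6: a quotient of at least L means a \<le> n / L, and these a
  contribute at most 2 * C * sqrt n * 2 * sqrt (n / L); the tail of the series contributes the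
  6.\<close>

lemma total_error:
  fixes f :: "nat \<Rightarrow> nat \<Rightarrow> real"
  assumes bound: "\<And>a n. 1 \<le> a \<Longrightarrow> a \<le> n \<Longrightarrow> \<bar>f a n\<bar> \<le> C * (1 + ln (real n / real a))" and C: "C \<ge> 0"
    and "L \<ge> 1" and tail: "\<bar>Cf - (\<Sum>i\<in>{1..<L}. g i)\<bar> \<le> 6 * C / sqrt (real L)"
  shows "\<bar>(\<Sum>a=1..n. f a n) - real n * Cf\<bar>
    \<le> (\<Sum>i\<in>{1..<L}. \<bar>(\<Sum>a | a \<in> {1..n} \<and> n div a = i. f a n) - real n * g i\<bar>)
      + 10 * C * real n / sqrt (real L)"
proof -
  define P where "P = {a \<in> {1..n}. n div a < L}"
  define Q where "Q = {a \<in> {1..n}. L \<le> n div a}"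
  have "{1..n} = P \<union> Q" "P \<inter> Q = {}" "finite P" "finite Q" by (auto simp: P_def Q_def)
  then have "(\<Sum>a=1..n. f a n) = (\<Sum>a\<in>P. f a n) + (\<Sum>a\<in>Q. f a n)" by (simp add: sum.union_disjoint)
  also have "(\<Sum>a\<in>P. f a n) = (\<Sum>i\<in>{1..<L}. \<Sum>a | a \<in> P \<and> n div a = i. f a n)"
    by (rule sum.group[symmetric]) (auto simp: P_def Suc_le_eq div_greater_zero_iff)
  also have "\<dots> = (\<Sum>i\<in>{1..<L}. \<Sum>a | a \<in> {1..n} \<and> n div a = i. f a n)"
    by (intro sum.cong refl) (auto simp: P_def)
  finally have split: "(\<Sum>a=1..n. f a n)
      = (\<Sum>i\<in>{1..<L}. \<Sum>a | a \<in> {1..n} \<and> n div a = i. f a n) + (\<Sum>a\<in>Q. f a n)" .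
  have "\<bar>\<Sum>a\<in>Q. f a n\<bar> \<le> (\<Sum>a\<in>Q. 2 * C * sqrt (real n) * (1 / sqrt (real a)))"
  proof (rule order_trans[OF sum_abs sum_mono])
    fix a assume "a \<in> Q"
    then have a: "1 \<le> a" "a \<le> n" by (auto simp: Q_def)
    have "C * (1 + ln (real n / real a)) \<le> C * (2 * sqrt (real n / real a))"
      using a C by (intro mult_left_mono one_plus_ln_le_sqrt) auto
    then show "\<bar>f a n\<bar> \<le> 2 * C * sqrt (real n) * (1 / sqrt (real a))"
      using bound[OF a] by (simp add: real_sqrt_divide mult_ac)
  qed
  also have "\<dots> \<le> (\<Sum>a=1..n div L. 2 * C * sqrt (real n) * (1 / sqrt (real a)))"
  proof (rule sum_mono2)
    have "a \<le> n div L" if "a \<in> Q" for a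
    proof -
      have "0 < a" "L \<le> n div a" using that by (auto simp: Q_def)
      then have "L * a \<le> n" by (simp add: less_eq_div_iff_mult_less_eq)
      then show ?thesis using \<open>L \<ge> 1\<close> by (simp add: less_eq_div_iff_mult_less_eq mult.commute)
    qed
    then show "Q \<subseteq> {1..n div L}" by (auto simp: Q_def)
  qed (use C in auto)
  also have "\<dots> = 2 * C * sqrt (real n) * (\<Sum>a=1..n div L. 1 / sqrt (real a))"
    by (rule sum_distrib_left[symmetric])
  also have "\<dots> \<le> 2 * C * sqrt (real n) * (2 * sqrt (real (n div L)))"
    using C by (intro mult_left_mono sum_inverse_sqrt_le) auto
  also have "\<dots> \<le> 2 * C * sqrt (real n) * (2 * sqrt (real n / real L))"
    using C by (intro mult_left_mono real_sqrt_le_mono of_nat_div_le_of_nat) auto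
  also have "\<dots> = 4 * C * (sqrt (real n) * sqrt (real n)) / sqrt (real L)"
    by (simp add: real_sqrt_divide)
  finally have Q: "\<bar>\<Sum>a\<in>Q. f a n\<bar> \<le> 4 * C * real n / sqrt (real L)" by simp
  have "\<bar>real n * (Cf - (\<Sum>i\<in>{1..<L}. g i))\<bar> \<le> real n * (6 * C / sqrt (real L))"
    using mult_left_mono[OF tail of_nat_0_le_iff[of n]] by (simp only: abs_mult abs_of_nat)
  moreover have "(\<Sum>a=1..n. f a n) - real n * Cf
      = (\<Sum>i\<in>{1..<L}. (\<Sum>a | a \<in> {1..n} \<and> n div a = i. f a n) - real n * g i)
        + (\<Sum>a\<in>Q. f a n) - real n * (Cf - (\<Sum>i\<in>{1..<L}. g i))"
    unfolding split by (simp add: sum_subtractf sum_distrib_left algebra_simps)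
  moreover have "\<bar>\<Sum>i\<in>{1..<L}. (\<Sum>a | a \<in> {1..n} \<and> n div a = i. f a n) - real n * g i\<bar>
      \<le> (\<Sum>i\<in>{1..<L}. \<bar>(\<Sum>a | a \<in> {1..n} \<and> n div a = i. f a n) - real n * g i\<bar>)"
    by (rule sum_abs)
  moreover have "10 * C * real n / sqrt (real L) = 4 * C * real n / sqrt (real L) + real n * (6 * C / sqrt (real L))"
    by (simp add: field_simps)
  ultimately show ?thesis using Q by linarith
qed

theorem theorem5p2:
  fixes f :: "nat \<Rightarrow> nat \<Rightarrow> real" and \<epsilon> :: real
  assumes eps: "\<epsilon> > 0"
    and dep: "depends_only_on_component D_edge f \<or> depends_only_on_component L_edge f"
    and bound: "\<exists>C. \<forall>a n. 1 \<le> a \<longrightarrow> a \<le> n \<longrightarrow> \<bar>f a n\<bar> \<le> C * (1 + ln (real n / real a))"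
  shows "\<exists>Cf::real.
     (\<forall>i\<ge>1. Cf_term f i summable_on {d. 1 \<le> d \<and> gpf d \<le> i}) \<and>
     (\<lambda>k. infsum (Cf_term f (Suc k)) {d. 1 \<le> d \<and> gpf d \<le> Suc k}) sums Cf \<and>
     (\<lambda>n::nat. (\<Sum>a=1..n. f a n) - real n * Cf)
        \<in> O(\<lambda>n. real n * exp (- (1 - \<epsilon>) * sqrt (ln (real n) * ln (ln (real n)))))"
proof -
  obtain C where bound: "\<And>a n. 1 \<le> a \<Longrightarrow> a \<le> n \<Longrightarrow> \<bar>f a n\<bar> \<le> C * (1 + ln (real n / real a))"
    using assms(3) by blast
  have C: "C \<ge> 0" using bound[of 1 1] by simp
  define g where "g i = infsum (Cf_term f i) (smooth_numbers (primes_le (real i)))" for i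
  note fB = f_bound_on_block[where f = f, OF bound C]
  have summable: "Cf_term f i summable_on smooth_numbers (primes_le (real i))" if "i \<ge> 1" for i
    by (rule Cf_term_summable(1)[OF that fB[OF _ _ that]])
  have g: "\<bar>g i\<bar> \<le> 6 * C / sqrt (real i) - 6 * C / sqrt (real i + 1)" if "i \<ge> 1" for i
  proof -
    have "\<bar>g i\<bar> \<le> C * (1 + ln (real i + 1)) / (real i * (real i + 1))"
      unfolding g_def by (rule Cf_term_summable(2)[OF that fB[OF _ _ that]])
    also have "\<dots> \<le> C * (2 * sqrt (real i + 1)) / (real i * (real i + 1))"
      using C by (intro divide_right_mono mult_left_mono one_plus_ln_le_sqrt) auto
    also have "\<dots> \<le> C * (6 / sqrt (real i) - 6 / sqrt (real i + 1))"
      using mult_left_mono[OF sqrt_telescope_bound[OF that] C] by simp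
    finally show ?thesis by (simp add: algebra_simps)
  qed
  define u where "u k = 6 * C / sqrt (real (Suc k))" for k
  have u: "\<bar>g (Suc k)\<bar> \<le> u k - u (Suc k)" for k
    using g[of "Suc k"] by (simp add: u_def add.commute)
  have u0: "u \<longlonglongrightarrow> 0" unfolding u_def by real_asymp
  \<comment> \<open>The constant is built without reference to \<open>\<epsilon>\<close>, which
    enters only through the number \<open>K\<close> of blocks per unit of c.\<close>
  define Cf where "Cf = (\<Sum>k. g (Suc k))"
  have sums: "(\<lambda>k. g (Suc k)) sums Cf"
    unfolding Cf_def by (rule summable_sums[OF tail_le_telescope(1)[OF u u0]])
  have tail: "\<bar>Cf - (\<Sum>i\<in>{1..<L}. g i)\<bar> \<le> 6 * C / sqrt (real L)" if L: "L \<ge> 1" for L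
  proof -
    have "(\<Sum>k<L - 1. g (Suc k)) = (\<Sum>i\<in>{1..<L}. g i)"
      using sum.shift_bounds_Suc_ivl[of g 0 "L - 1"] L by (simp add: atLeast0LessThan)
    then show ?thesis using tail_le_telescope(2)[OF u u0, of "L - 1"] L by (simp add: u_def Cf_def)
  qed
  obtain K :: nat where K: "K \<ge> 2" "3 / real K \<le> \<epsilon>"
  proof -
    obtain K0 :: nat where K0: "real K0 > 3 / \<epsilon>" using reals_Archimedean2 by blast
    have "3 / \<epsilon> \<le> real (max 2 K0)" using K0 by simp
    then have "3 / real (max 2 K0) \<le> \<epsilon>" using eps by (simp add: field_simps)
    then show ?thesis using that[of "max 2 K0"] by simp
  qed
  define S where "S n = sqrt (ln (real n) * ln (ln (real n)))" for n :: nat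
  \<comment> \<open>The part 4 * K stands for 2 * K blocks of cost 2 each, the part 10 * C for
    everything beyond the blocks.\<close>
  have "eventually (\<lambda>n. norm ((\<Sum>a=1..n. f a n) - real n * Cf)
      \<le> (4 * real K + 10 * C) * norm (real n * exp (- (1 - \<epsilon>) * S n))) at_top"
    using eventually_block_conditions[OF K(1) C]
  proof eventually_elim
    case (elim n)
    note cond = elim[folded S_def]
    have S: "S n \<ge> 2" using cond K by linarith
    define h where "h i = \<bar>(\<Sum>a | a \<in> {1..n} \<and> n div a = i. f a n) - real n * g i\<bar>" for i
    \<comment> \<open>The 2 * K blocks, each of logarithmic length S/K, end at exp (2 * S), and 1 /
      sqrt L is then at most exp (-S).\<close>
    define L where "L = nat \<lceil>exp (2 * S n)\<rceil>"
    have L: "L \<ge> 1" "exp (2 * S n) \<le> real L"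
      using exp_gt_zero[of "2 * S n"] unfolding L_def by linarith+
    have "real (2 * K) * S n / real K = 2 * S n" using K by simp
    \<comment> \<open>An integer lies below the ceiling of a real number exactly if it lies below
      the number itself, so the blocks exhaust \<open>{1..<L}\<close>.\<close>
    then have set: "{1..<L} = {i. 1 \<le> i \<and> real i < exp (real (2 * K) * S n / real K)}"
      unfolding L_def by (auto simp: zless_nat_eq_int_zless less_ceiling_iff simp del: of_nat_mult)
    have block: "(\<Sum>i | exp (real j * S n / real K) \<le> real i \<and> real i < exp (real (Suc j) * S n / real K). h i)
      \<le> 2 * real n * exp (- (1 - 3 / real K) * S n)" if "j \<in> {..<2 * K}" for j
      unfolding h_def g_def S_def
      by (rule block_error_asymp[OF dep bound C K(1)]) (use that elim in auto)
    have "(\<Sum>i\<in>{1..<L}. h i) \<le> (\<Sum>j<2 * K. 2 * real n * exp (- (1 - 3 / real K) * S n))"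
      unfolding set sum_exp_blocks[OF order_trans[OF zero_le_numeral S]]
      by (rule sum_mono[OF block])
    also have "\<dots> = 4 * real K * (real n * exp (- (1 - 3 / real K) * S n))" by simp
    also have "\<dots> \<le> 4 * real K * (real n * exp (- (1 - \<epsilon>) * S n))"
    proof -
      have "(1 - \<epsilon>) * S n \<le> (1 - 3 / real K) * S n" using K S by (intro mult_right_mono) auto
      then have "exp (- (1 - 3 / real K) * S n) \<le> exp (- (1 - \<epsilon>) * S n)"
        by (simp only: exp_le_cancel_iff mult_minus_left neg_le_iff_le)
      then show ?thesis by (intro mult_left_mono) auto
    qed
    finally have main: "(\<Sum>i\<in>{1..<L}. h i) \<le> 4 * real K * (real n * exp (- (1 - \<epsilon>) * S n))" .
    have "10 * C * real n / sqrt (real L) \<le> 10 * C * (real n * exp (- (1 - \<epsilon>) * S n))"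
    proof -
      have "exp (2 * S n) = (exp (S n))\<^sup>2" by (simp add: power2_eq_square flip: exp_add)
      then have "exp (S n) \<le> sqrt (real L)" using L(2) by (intro real_le_rsqrt) simp
      then have "10 * C * real n / sqrt (real L) \<le> 10 * C * real n / exp (S n)"
        using C by (intro divide_left_mono) (auto intro: mult_pos_pos less_le_trans[OF exp_gt_zero])
      also have "\<dots> = 10 * C * (real n * exp (- S n))" by (simp add: exp_minus divide_inverse)
      also have "\<dots> \<le> 10 * C * (real n * exp (- (1 - \<epsilon>) * S n))"
        using C eps S by (intro mult_left_mono) (auto simp: algebra_simps)
      finally show ?thesis .
    qed
    with main total_error[where f = f and g = g, OF bound C L(1) tail[OF L(1)], of n]
    show ?case unfolding h_def by (simp add: algebra_simps)
  qed
  then have bigo: "(\<lambda>n::nat. (\<Sum>a=1..n. f a n) - real n * Cf)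
      \<in> O(\<lambda>n. real n * exp (- (1 - \<epsilon>) * sqrt (ln (real n) * ln (ln (real n)))))"
    unfolding S_def by (rule bigoI)
  have "Cf_term f i summable_on {d. 1 \<le> d \<and> gpf d \<le> i}" if "i \<ge> 1" for i
    using summable[OF that] smooth_numbers_gpf[OF that] by simp
  moreover have "infsum (Cf_term f (Suc k)) {d. 1 \<le> d \<and> gpf d \<le> Suc k} = g (Suc k)" for k
    using smooth_numbers_gpf[of "Suc k"] by (simp add: g_def)
  ultimately show ?thesis using sums bigo by (intro exI[of _ Cf]) simp
qed

end
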